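(* Let $g^*(z)=z\bigl(\psi(-z/2)-\psi((1-z)/2)\bigr)$ and let $R:[1,\infty)\to\mathbb{C}$ be the resolvent kernel defined below. Let $\alpha_1$ be a real number such that $g^*(z)\neq0$ for all $z$ with $\operatorname{Re}(z)<\alpha_1$. Then for every $\varepsilon>0$, $$R(y)=O_\varepsilon\bigl(y^{-\alpha_1+\varepsilon}\bigr)\qquad(y\to\infty).$$
   Context: $\psi$ is the digamma function; $g^*$ is the meromorphic continuation of $-z\int_0^1\frac{2}{1+t}\,t^{-z-1}\,dt$ (defined for $\operatorname{Re} z<0$), with $g^*(0)=2$. Let $k(y)=\frac{2y}{(1+y)^2}$ for $y\ge1$, $(F\star H)(x)=\int_1^xF(x/y)H(y)\,\frac{dy}{y}$, $k^{\star1}=k$, $k^{\star(n+1)}=k^{\star n}\star k$. The resolvent kernel is $R=\sum_{n\ge1}(-1)^{n+1}k^{\star n}$ (converging uniformly on compact subsets of $[1,\infty)$); it is the unique locally bounded solution of $R+R\star k=k$, and its Mellin transform $\int_1^\infty R(y)y^{-s}\frac{dy}{y}$ equals $1-1/g^*(-s)$ for $\operatorname{Re}(s)>1$. *)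

theory Defs
  imports "HOL-Complex_Analysis.Complex_Analysis"
begin

text \<open>
  The formula in the else branch has a removable singularity at \<open>0\<close>, with limit \<open>2\<close>, but the library's
  totalised digamma function makes the product \<open>0\<close> there, so that value is set explicitly.
  At the poles \<open>1, 2, 3, \<dots>\<close> the value of \<open>gstar\<close> is meaningless.
\<close>
definition gstar :: "complex \<Rightarrow> complex" where
  "gstar z = (if z = 0 then 2 else z * (Digamma (- z / 2) - Digamma ((1 - z) / 2)))"

definition mconv :: "(real \<Rightarrow> complex) \<Rightarrow> (real \<Rightarrow> complex) \<Rightarrow> real \<Rightarrow> complex"  (infixl "\<star>" 70)
  where "(F \<star> H) x = integral {1..x} (\<lambda>y. F (x / y) * H y / complex_of_real y)"

text \<open>Only the values at \<open>n \<ge> 1\<close> are meaningful.\<close>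
definition mconv_pow :: "(real \<Rightarrow> complex) \<Rightarrow> nat \<Rightarrow> real \<Rightarrow> complex" where
  "mconv_pow F n = ((\<lambda>G. G \<star> F) ^^ (n - 1)) F"

lemma mconv_pow_1: "mconv_pow F 1 = F"
  by (simp add: mconv_pow_def)

lemma mconv_pow_Suc: "n \<ge> 1 \<Longrightarrow> mconv_pow F (n + 1) = mconv_pow F n \<star> F"
  by (cases n) (simp_all add: mconv_pow_def)

definition kernel_k :: "real \<Rightarrow> complex" where
  "kernel_k y = complex_of_real (2 * y / (1 + y)\<^sup>2)"

text \<open>The series over \<open>n \<ge> 1\<close> is indexed from \<open>0\<close> through \<open>Suc\<close>.\<close>
definition resolvent_R :: "real \<Rightarrow> complex" where
  "resolvent_R y = (\<Sum>n. (-1) ^ (Suc n + 1) * mconv_pow kernel_k (Suc n) y)"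

end

theory Submission
  imports Defs
begin

text \<open>
  Put \<open>s = -z\<close>. The function \<open>gstar (-s)\<close> is \<open>1\<close> plus the Mellin transform of the kernel, so the
  transform of \<open>R\<close> is \<open>1 - 1/gstar (-s)\<close>, which by hypothesis is holomorphic for \<open>Re s > -\<alpha>\<^sub>1\<close>
  (the poles of \<open>gstar\<close> only produce zeros of the reciprocal) and equals \<open>1/(2s) + O(|s|\<^sup>-\<^sup>2)\<close> in every
  right half-plane. After subtracting \<open>1/(2(s+A))\<close>, the transform of \<open>y\<^sup>-\<^sup>A/2\<close>, the remainder \<open>H\<close> is
  absolutely integrable on the line \<open>Re s = c = -\<alpha>\<^sub>1 + \<epsilon>\<close>, and its inverse Mellin integral along that
  line is \<open>O(y\<^sup>c)\<close>. Instead of inverting the transform of \<open>R\<close> and shifting the contour, one checks by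
  Fubini and Cauchy's formula that this integral has Mellin transform \<open>H\<close>, and concludes because a
  continuous, polynomially bounded function is determined by its Mellin transform at large integers
  (Weierstrass approximation in the variable \<open>1/y\<close>).
\<close>

section \<open>Asymptotics and poles of \<open>gstar\<close>\<close>

text \<open>The term 1/(2s) reflects the jump of R at y = 1, where R(1) = k(1) = 1/2; it keeps the
  unmodified transform from being absolutely integrable on a vertical line. It is cancelled by
  1/(2(s+A)) because the pole 0 of 1/(2s) may lie on or to the right of the line, while -A can
  always be placed to its left. The asymptotics, the limit at 0 and the simple poles to the left of
  Re s = 1 all come from the functional equation \<open>gstar_shift\<close>, which carries
  information one unit to the left at a time. One plus the transform of the kernel satisfies the
  same recurrence along the positive integers. The distance between the two solutions cannot
  decrease as m grows, yet it tends to 0, so they agree; this is how \<open>gstar\<close> is linked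
  to the kernel. The bound on H is proved on the whole half-plane Re s >= c, and not only on the
  line, because Cauchy's formula is applied to rectangles that grow to the right. R itself enters
  through the crude bound O(y^2) of its series, which makes its transform available at real m >
  2.\<close>

lemma gstar_shift:
  assumes "s \<noteq> -1"
  shows "gstar (-s) = 2 - s / (s + 1) * gstar (- (s + 1))"
proof (cases "s = 0")
  case True
  then show ?thesis by (simp add: gstar_def)
next
  case False
  have ne: "s + 1 \<noteq> 0" using assms by (simp add: add_eq_0_iff2)
  have "Digamma (s / 2 + 1) = Digamma (s / 2) + 1 / (s / 2)"
    using False by (intro Digamma_plus1) simp
  moreover have "(1 - (-(s + 1))) / 2 = s / 2 + 1" by (simp add: field_simps)
  ultimately show ?thesis using False ne assms not_sym[OF assms]
    by (simp add: gstar_def field_simps)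
qed

lemma norm_add_nat_ge:
  fixes s :: complex
  assumes "Re s \<ge> 1"
  shows "norm s \<le> norm (s + of_nat n)" "real n + 1 \<le> norm (s + of_nat n)"
proof -
  have "(norm s)\<^sup>2 \<le> (norm (s + of_nat n))\<^sup>2"
    using assms by (simp add: cmod_power2 power_mono)
  then show "norm s \<le> norm (s + of_nat n)" by (rule power2_le_imp_le) simp
  have "real n + 1 \<le> Re (s + of_nat n)" using assms by simp
  also have "\<dots> \<le> norm (s + of_nat n)" by (rule complex_Re_le_cmod)
  finally show "real n + 1 \<le> norm (s + of_nat n)" .
qed

text \<open>In the difference of the two digamma series the Euler constants and the terms 1/(k+1)
  cancel, and 2/(s+2k) - 2/(s+2k+1) remains. This is the Mellin transform side of an alternating
  series, grouped in pairs so that it converges absolutely.\<close>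

lemma gstar_sums:
  assumes "Re s \<ge> 1"
  shows "(\<lambda>k. 2 * s / ((s + of_nat (2*k)) * (s + of_nat (2*k) + 1))) sums gstar (-s)"
proof -
  have ne: "s + of_nat n \<noteq> 0" for n
    using norm_add_nat_ge(2)[OF assms, of n] by auto
  have ne1: "s + of_nat n + 1 \<noteq> 0" for n
    using ne[of "Suc n"] by (simp add: add_ac)
  have s0: "s \<noteq> 0" "s + 1 \<noteq> 0" using ne[of 0] ne[of 1] by auto
  have D: "(\<lambda>n. inverse (of_nat (Suc n)) - inverse (z + of_nat n)) sums (Digamma z + euler_mascheroni)"
    if "z \<noteq> 0" for z :: complex
    using summable_Digamma[OF that] by (simp add: Digamma_def summable_sums)
  have "(\<lambda>k. s * ((inverse (of_nat (Suc k)) - inverse ((s + 1) / 2 + of_nat k)) -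
        (inverse (of_nat (Suc k)) - inverse (s / 2 + of_nat k))))
      sums (s * ((Digamma ((s + 1) / 2) + euler_mascheroni) - (Digamma (s / 2) + euler_mascheroni)))"
    using s0 by (intro sums_mult sums_diff D) auto
  also have "(\<lambda>k. s * ((inverse (of_nat (Suc k)) - inverse ((s + 1) / 2 + of_nat k)) -
        (inverse (of_nat (Suc k)) - inverse (s / 2 + of_nat k)))) =
      (\<lambda>k. 2 * s / ((s + of_nat (2*k)) * (s + of_nat (2*k) + 1)))"
  proof
    fix k
    have a: "s / 2 + of_nat k = (s + of_nat (2*k)) / 2" 
      "(s + 1) / 2 + of_nat k = (s + of_nat (2*k) + 1) / 2" by (simp_all add: field_simps)
    show "s * ((inverse (of_nat (Suc k)) - inverse ((s + 1) / 2 + of_nat k)) -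
        (inverse (of_nat (Suc k)) - inverse (s / 2 + of_nat k))) =
      2 * s / ((s + of_nat (2*k)) * (s + of_nat (2*k) + 1))"
      unfolding a using ne[of "2*k"] ne1[of "2*k"]
      by (simp add: divide_simps del: of_nat_mult) (simp add: algebra_simps)
  qed
  also have "s * ((Digamma ((s + 1) / 2) + euler_mascheroni) - (Digamma (s / 2) + euler_mascheroni)) 
      = gstar (-s)"
    using s0 by (simp add: gstar_def algebra_simps)
  finally show ?thesis .
qed

text \<open>
  With \<open>T(s) = 1/s + 1/(2s\<^sup>2)\<close> one has \<open>T(s) - T(s+2) - 2/(s(s+1)) = 2/(s\<^sup>2(s+1)(s+2)\<^sup>2)\<close>,
  so subtracting a telescoping series leaves one whose terms are of fifth order.
\<close>
lemma gstar_asymp_right: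
  obtains C where "C \<ge> 0" "\<And>s. Re s \<ge> 1 \<Longrightarrow> norm (gstar (-s) - 1 - 1 / (2 * s)) \<le> C / norm s ^ 2"
proof
  let ?S = "\<Sum>k. 1 / (real k + 1) ^ 2"
  have summ: "summable (\<lambda>k. 1 / (real k + 1) ^ 2)"
    using summable_Suc_iff[of "\<lambda>k. 1 / real k ^ 2"] inverse_power_summable[of 2, where 'a=real]
    by (simp add: divide_inverse add_ac)
  show "2 * ?S \<ge> 0" using summ by (intro mult_nonneg_nonneg suminf_nonneg) auto
  fix s :: complex assume s: "Re s \<ge> 1"
  have ne: "s + of_nat n \<noteq> 0" for n
    using norm_add_nat_ge(2)[OF s, of n] by auto
  have s0: "s \<noteq> 0" using ne[of 0] by auto
  define T where "T = (\<lambda>k. 1 / (s + of_nat (2*k)) + 1 / (2 * (s + of_nat (2*k))^2))"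
  have inf: "filterlim (\<lambda>k. s + of_nat (2*k)) at_infinity sequentially"
    by (intro tendsto_add_filterlim_at_infinity[OF tendsto_const]
          filterlim_compose[OF tendsto_of_nat]) (auto intro!: filterlim_subseq simp: strict_mono_def)
  have "(\<lambda>k. inverse (s + of_nat (2*k)) + inverse (s + of_nat (2*k))^2 / 2) \<longlonglongrightarrow> 0 + 0^2/2"
    by (intro tendsto_intros filterlim_compose[OF tendsto_inverse_0 inf]) auto
  then have T0: "T \<longlonglongrightarrow> 0" unfolding T_def by (simp add: field_simps)
  have "(\<lambda>k. T k - T (Suc k)) sums (T 0 - 0)"
    by (rule telescope_sums'[OF T0])
  then have "(\<lambda>k. s * (T k - T (Suc k)) - 2 * s / ((s + of_nat (2*k)) * (s + of_nat (2*k) + 1)))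
     sums (s * (T 0 - 0) - gstar (-s))"
    using sums_diff[OF sums_mult[of _ _ s] gstar_sums[OF s]] by blast
  also have "s * (T 0 - 0) - gstar (-s) = - (gstar (-s) - 1 - 1 / (2 * s))"
    using s0 by (simp add: T_def field_simps power2_eq_square)
  finally have sums: "(\<lambda>k. s * (T k - T (Suc k)) - 2 * s / ((s + of_nat (2*k)) * (s + of_nat (2*k) + 1)))
     sums (- (gstar (-s) - 1 - 1 / (2 * s)))" .
  have bound: "norm (s * (T k - T (Suc k)) - 2 * s / ((s + of_nat (2*k)) * (s + of_nat (2*k) + 1)))
      \<le> 2 / norm s ^ 2 * (1 / (real k + 1) ^ 2)" for k
  proof -
    define w where "w = s + of_nat (2*k)"
    have w: "w \<noteq> 0" "w + 1 \<noteq> 0" "w + 2 \<noteq> 0"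
      using ne[of "2*k"] ne[of "2*k+1"] ne[of "2*k+2"] by (simp_all add: w_def add_ac)
    have nw: "norm s \<le> norm w" "norm s \<le> norm (w + 1)" "norm s \<le> norm (w + 2)"
       "real k + 1 \<le> norm w" "real k + 1 \<le> norm (w + 2)"
      using norm_add_nat_ge[OF s, of "2*k"] norm_add_nat_ge[OF s, of "2*k+1"] norm_add_nat_ge[OF s, of "2*k+2"]
      by (simp_all add: w_def add_ac)
    have "s * (T k - T (Suc k)) - 2 * s / ((s + of_nat (2*k)) * (s + of_nat (2*k) + 1)) =
      s * (1 / w + 1 / (2 * w^2) - (1 / (w + 2) + 1 / (2 * (w + 2)^2)) - 2 / (w * (w + 1)))"
      by (simp add: T_def w_def algebra_simps)
    also have "1 / w + 1 / (2 * w^2) - (1 / (w + 2) + 1 / (2 * (w + 2)^2)) - 2 / (w * (w + 1))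
       = 2 / (w^2 * (w + 1) * (w + 2)^2)"
      using w by (simp add: divide_simps) algebra
    finally have "norm (s * (T k - T (Suc k)) - 2 * s / ((s + of_nat (2*k)) * (s + of_nat (2*k) + 1)))
      = 2 * norm s / ((norm w * norm w * norm (w + 1)) * (norm (w + 2) * norm (w + 2)))"
      by (simp add: norm_mult norm_divide norm_power power2_eq_square mult_ac)
    \<comment> \<open>Of the five denominators, three are traded for the norm of \<open>s\<close>,
      which beats the numerator and leaves the required inverse square; the other two are traded for
      k+1, which makes the sum over k converge.\<close>
    also have "\<dots> = 2 * norm s / ((norm w * norm (w + 1) * norm (w + 2)) * (norm w * norm (w + 2)))"
      by (simp add: mult_ac)
    also have "\<dots> \<le> 2 * norm s / ((norm s * norm s * norm s) * ((real k + 1) * (real k + 1)))"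
      using nw s0 by (intro divide_left_mono mult_mono mult_pos_pos) (auto simp: w)
    also have "\<dots> = 2 / norm s ^ 2 * (1 / (real k + 1) ^ 2)"
      using s0 by (simp add: divide_simps power2_eq_square)
    finally show ?thesis .
  qed
  have summ2: "summable (\<lambda>k. 2 / norm s ^ 2 * (1 / (real k + 1) ^ 2))"
    by (rule summable_mult[OF summ])
  have "norm (gstar (-s) - 1 - 1 / (2 * s)) = norm (- (gstar (-s) - 1 - 1 / (2 * s)))"
    by (simp only: norm_minus_cancel)
  also have "\<dots> = norm (\<Sum>k. s * (T k - T (Suc k)) - 2 * s / ((s + of_nat (2*k)) * (s + of_nat (2*k) + 1)))"
    using sums by (simp add: sums_iff)
  also have "\<dots> \<le> (\<Sum>k. 2 / norm s ^ 2 * (1 / (real k + 1) ^ 2))"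
    by (rule norm_suminf_le[OF bound summ2])
  also have "\<dots> = 2 * ?S / norm s ^ 2"
    by (subst suminf_mult[OF summ]) simp
  finally show "norm (gstar (-s) - 1 - 1 / (2 * s)) \<le> 2 * ?S / norm s ^ 2" .
qed

text \<open>Each induction step applies \<open>gstar_shift\<close> and moves the boundary of the
  half-plane one unit to the left. The expansion survives because 1 + 1/(2s) satisfies the
  functional equation up to an error of second order. The radius \<open>r\<close> keeps
  \<open>s\<close> away from the poles met on the way.\<close>

lemma gstar_asymp:
  obtains C r where "C \<ge> 0" "r \<ge> 1"
    "\<And>s. Re s \<ge> c \<Longrightarrow> norm s \<ge> r \<Longrightarrow> norm (gstar (-s) - 1 - 1 / (2 * s)) \<le> C / norm s ^ 2"
proof -
  have "\<exists>C r. C \<ge> 0 \<and> r \<ge> 1 \<and> (\<forall>s. Re s \<ge> 1 - real n \<longrightarrow> norm s \<ge> r \<longrightarrow>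
      norm (gstar (-s) - 1 - 1 / (2 * s)) \<le> C / norm s ^ 2)" for n
  proof (induction n)
    case 0
    obtain C where "C \<ge> 0" "\<And>s. Re s \<ge> 1 \<Longrightarrow> norm (gstar (-s) - 1 - 1 / (2 * s)) \<le> C / norm s ^ 2"
      using gstar_asymp_right by blast
    then show ?case by (intro exI[of _ C] exI[of _ 1]) auto
  next
    case (Suc n)
    then obtain C r where C: "C \<ge> 0" "r \<ge> 1" and
      IH: "\<And>s. Re s \<ge> 1 - real n \<Longrightarrow> norm s \<ge> r \<Longrightarrow> norm (gstar (-s) - 1 - 1 / (2 * s)) \<le> C / norm s ^ 2"
      by blast
    show ?case
    proof (intro exI conjI allI impI)
      \<comment> \<open>The three error terms below contribute 2, 1 and 2 times 4C. Raising the
        radius by 2 ensures that \<open>s + 1\<close> still has norm at least \<open>r\<close> and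
        at least half the norm of \<open>s\<close>.\<close>
      show "3 + 8 * C \<ge> 0" "r + 2 \<ge> 1" using C by auto
      fix s :: complex assume s: "1 - real (Suc n) \<le> Re s" "r + 2 \<le> norm s"
      have n1: "norm (s + 1) \<ge> norm s - 1"
        using norm_diff_ineq[of s 1] by simp
      have n2: "norm (s + 1) \<ge> norm s / 2" "norm (s + 1) \<ge> r" using n1 s C by auto
      have s0: "s \<noteq> 0" "s + 1 \<noteq> 0" using n2 s C by auto
      define E where "E = gstar (-(s + 1)) - 1 - 1 / (2*(s + 1))"
      have "norm E \<le> C / norm (s + 1) ^ 2"
        unfolding E_def using s n2 by (intro IH) auto
      also have "\<dots> \<le> C / (norm s / 2) ^ 2"
        using n2 s0 C by (intro divide_left_mono power_mono mult_pos_pos zero_less_power) auto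
      finally have E: "norm E \<le> 4 * C / norm s ^ 2" by (simp add: field_simps power2_eq_square)
      have g: "gstar (-(s+1)) = 1 + 1 / (2*(s + 1)) + E" by (simp add: E_def)
      have "gstar (-s) - 1 - 1 / (2 * s) = 1 / (2 * (s + 1)^2) - 1 / (2 * (s * (s + 1))) - s / (s + 1) * E"
      proof -
        have "s \<noteq> -1" using s0 by auto
        show ?thesis unfolding gstar_shift[OF \<open>s \<noteq> -1\<close>] g
          using s0 by (simp add: divide_simps) algebra
      qed
      also have "norm \<dots> \<le> norm (1 / (2 * (s + 1)^2)) + norm (1 / (2 * (s * (s + 1)))) + norm (s / (s + 1) * E)"
        using norm_triangle_ineq4[of "1 / (2 * (s + 1)^2) - 1 / (2 * (s * (s + 1)))" "s / (s + 1) * E"]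
          norm_triangle_ineq4[of "1 / (2 * (s + 1)^2)" "1 / (2 * (s * (s + 1)))"] by linarith
      also have "norm (1 / (2 * (s + 1)^2)) \<le> 2 / norm s ^ 2"
      proof -
        have "norm (1 / (2 * (s + 1)^2)) = 1 / (2 * norm (s + 1) ^ 2)"
          by (simp add: norm_divide norm_mult norm_power)
        also have "\<dots> \<le> 1 / (2 * (norm s / 2) ^ 2)"
          using n2 s0 by (intro divide_left_mono mult_left_mono power_mono mult_pos_pos zero_less_power) auto
        finally show ?thesis by (simp add: field_simps power2_eq_square)
      qed
      also have "norm (1 / (2 * (s * (s + 1)))) \<le> 1 / norm s ^ 2"
      proof -
        have "norm (1 / (2 * (s * (s + 1)))) = 1 / (2 * (norm s * norm (s + 1)))"
          by (simp add: norm_divide norm_mult norm_power)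
        also have "\<dots> \<le> 1 / (2 * (norm s * (norm s / 2)))"
          using n2 s0 by (intro divide_left_mono mult_left_mono power_mono mult_pos_pos zero_less_power) auto
        finally show ?thesis by (simp add: field_simps power2_eq_square)
      qed
      also have "norm (s / (s + 1) * E) \<le> 2 * (4 * C / norm s ^ 2)"
        unfolding norm_mult
      proof (intro mult_mono E)
        show "norm (s / (s + 1)) \<le> 2"
          using n2 s0 by (simp add: norm_divide field_simps)
      qed auto
      finally show "norm (gstar (-s) - 1 - 1 / (2 * s)) \<le> (3 + 8 * C) / norm s ^ 2"
        by (simp add: add_divide_distrib)
    qed
  qed
  moreover obtain n :: nat where n: "1 - c \<le> real n" using real_arch_simple by blast
  ultimately obtain C r where "C \<ge> 0" "r \<ge> 1" "\<And>s. Re s \<ge> 1 - real n \<Longrightarrow> norm s \<ge> r \<Longrightarrow>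
      norm (gstar (-s) - 1 - 1 / (2 * s)) \<le> C / norm s ^ 2" by blast
  with n show ?thesis by (intro that[of C r]) auto
qed

section \<open>Holomorphy and poles of \<open>gstar\<close>, and its reciprocal\<close>

lemma gstar_holomorphic:
  assumes "A \<inter> \<int>\<^sub>\<le>\<^sub>0 = {}"
  shows "(\<lambda>s. gstar (-s)) holomorphic_on A"
proof -
  have ne: "s / 2 \<notin> \<int>\<^sub>\<le>\<^sub>0" "(s + 1) / 2 \<notin> \<int>\<^sub>\<le>\<^sub>0" if "s \<in> A" for s
  proof -
    have s: "s \<notin> \<int>\<^sub>\<le>\<^sub>0" using assms that by auto
    show "s / 2 \<notin> \<int>\<^sub>\<le>\<^sub>0"
    proof
      assume "s / 2 \<in> \<int>\<^sub>\<le>\<^sub>0"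
      then obtain n where "s / 2 = - of_nat n" by (auto elim!: nonpos_Ints_cases')
      then have "s = - of_nat (2 * n)" by simp
      with s show False by (metis minus_of_nat_in_nonpos_Ints)
    qed
    show "(s + 1) / 2 \<notin> \<int>\<^sub>\<le>\<^sub>0"
    proof
      assume "(s + 1) / 2 \<in> \<int>\<^sub>\<le>\<^sub>0"
      then obtain n where "(s + 1) / 2 = - of_nat n" by (auto elim!: nonpos_Ints_cases')
      then have "s = - of_nat (2 * n + 1)" by (simp add: field_simps eq_neg_iff_add_eq_0)
      with s show False by (metis minus_of_nat_in_nonpos_Ints)
    qed
  qed
  have "(\<lambda>s. s * (Digamma ((s + 1) / 2) - Digamma (s / 2))) analytic_on A"
    using ne by (intro analytic_intros) auto
  then have "(\<lambda>s. s * (Digamma ((s + 1) / 2) - Digamma (s / 2))) holomorphic_on A"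
    by (rule analytic_imp_holomorphic)
  moreover have "s * (Digamma ((s + 1) / 2) - Digamma (s / 2)) = gstar (-s)" if "s \<in> A" for s
    using that assms by (auto simp: gstar_def algebra_simps)
  ultimately show ?thesis by (simp cong: holomorphic_cong)
qed

text \<open>The functional equation at s -> 0 involves the regular point s + 1 = 1, whose
  contribution is killed by the factor s/(s+1); only the constant 2 is left.\<close>

lemma gstar_tendsto_0: "((\<lambda>s. gstar (-s)) \<longlongrightarrow> 2) (at 0)"
proof -
  have "(\<lambda>s. gstar (-s)) holomorphic_on {s. 0 < Re s}"
    by (intro gstar_holomorphic) (auto elim!: nonpos_Ints_cases)
  then have "isCont (\<lambda>s. gstar (-s)) 1"
    by (intro continuous_on_interior[OF holomorphic_on_imp_continuous_on])
       (auto simp: interior_open open_halfspace_Re_gt)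
  then have "isCont (\<lambda>s. gstar (-(s + 1))) 0"
    using isCont_o2[of 0 "\<lambda>s. s + 1" "\<lambda>s. gstar (-s)"] by simp
  then have "((\<lambda>s. 2 - s / (s + 1) * gstar (-(s + 1))) \<longlongrightarrow> 2 - 0 / (0 + 1) * gstar (-(0 + 1))) (at 0)"
    by (intro tendsto_intros isContD) auto
  moreover have "\<forall>\<^sub>F s in at 0. 2 - s / (s + 1) * gstar (-(s + 1)) = gstar (-s)"
  proof -
    have "\<forall>\<^sub>F s in at (0::complex). s \<noteq> -1"
      by (rule tendsto_imp_eventually_ne[OF tendsto_ident_at]) simp
    then show ?thesis by eventually_elim (metis gstar_shift)
  qed
  ultimately have "((\<lambda>s. gstar (-s)) \<longlongrightarrow> 2 - 0 / (0 + 1) * gstar (-(0 + 1))) (at 0)"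
    by (rule Lim_transform_eventually)
  then show ?thesis by simp
qed


text \<open>Multiplying the functional equation by s + n + 1 passes the limit from -n to -(n+1),
  with the nonzero factor -(n+1)/n. The chain starts from the limit 2 at 0. That the limit does not
  vanish is what forces the reciprocal to tend to 0 at these points.\<close>

lemma gstar_simple_pole:
  assumes "n \<ge> 1"
  shows "\<exists>\<rho>. \<rho> \<noteq> 0 \<and> ((\<lambda>s. (s + of_nat n) * gstar (-s)) \<longlongrightarrow> \<rho>) (at (- of_nat n))"
  using assms
proof (induction n rule: dec_induct)
  case base
  have shift: "filterlim (\<lambda>s::complex. s + 1) (at 0) (at (-1))"
    by (auto simp: filterlim_at eventually_at_filter add_eq_0_iff2 intro!: tendsto_eq_intros)
  have "((\<lambda>s. 2 * (s + 1) - s * gstar (-(s + 1))) \<longlongrightarrow> 2 * ((-1) + 1) - (-1) * 2) (at (-1))"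
    by (intro tendsto_intros filterlim_compose[OF gstar_tendsto_0 shift])
  moreover have "\<forall>\<^sub>F s in at (-1). 2 * (s + 1) - s * gstar (-(s + 1)) = (s + 1) * gstar (-s)"
    using eventually_neq_at_within[of "-1 :: complex" "-1" UNIV]
  proof eventually_elim
    case (elim s)
    then have "s + 1 \<noteq> 0" by (simp add: add_eq_0_iff2)
    then show ?case unfolding gstar_shift[OF elim] by (simp add: field_simps)
  qed
  ultimately have "((\<lambda>s. (s + 1) * gstar (-s)) \<longlongrightarrow> 2 * ((-1) + 1) - (-1) * 2) (at (-1))"
    by (rule Lim_transform_eventually)
  then show ?case by (intro exI[of _ 2]) simp
next
  case (step n)
  then obtain \<rho> where \<rho>: "\<rho> \<noteq> 0" "((\<lambda>s. (s + of_nat n) * gstar (-s)) \<longlongrightarrow> \<rho>) (at (- of_nat n))"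
    by blast
  let ?a = "- of_nat (Suc n) :: complex"
  have n0: "of_nat n \<noteq> (0::complex)" using step by simp
  have shift: "filterlim (\<lambda>s::complex. s + 1) (at (- of_nat n)) (at ?a)"
  proof (rule filterlim_atI)
    show "((\<lambda>s. s + 1) \<longlongrightarrow> - of_nat n) (at ?a)" by (auto intro!: tendsto_eq_intros)
    show "\<forall>\<^sub>F s in at ?a. s + 1 \<noteq> - of_nat n"
      using eventually_neq_at_within[of ?a ?a UNIV] by eventually_elim (auto simp: complex_eq_iff)
  qed
  have "((\<lambda>s. 2 * (s + of_nat (Suc n)) - s / (s + 1) * ((s + 1 + of_nat n) * gstar (-(s + 1)))) \<longlongrightarrow>
     2 * (?a + of_nat (Suc n)) - ?a / (?a + 1) * \<rho>) (at ?a)"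
    using n0 by (intro tendsto_intros filterlim_compose[OF \<rho>(2) shift]) auto
  moreover have "\<forall>\<^sub>F s in at ?a. 2 * (s + of_nat (Suc n)) - s / (s + 1) * ((s + 1 + of_nat n) * gstar (-(s + 1))) =
     (s + of_nat (Suc n)) * gstar (-s)"
  proof -
    have "\<forall>\<^sub>F s in at ?a. s \<noteq> -1"
      using n0 by (intro tendsto_imp_eventually_ne[OF tendsto_ident_at]) auto
    then show ?thesis
    proof eventually_elim
      case (elim s)
      have "2 * p - q * (p * g) = p * (2 - q * g)" for p q g :: complex
        by (simp add: algebra_simps)
      moreover have "s + 1 + of_nat n = s + of_nat (Suc n)" by simp
      ultimately show ?case unfolding gstar_shift[OF elim] by (simp only:)
    qed
  qed
  ultimately have "((\<lambda>s. (s + of_nat (Suc n)) * gstar (-s)) \<longlongrightarrow>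
       2 * (?a + of_nat (Suc n)) - ?a / (?a + 1) * \<rho>) (at ?a)"
    by (rule Lim_transform_eventually)
  moreover have "2 * (?a + of_nat (Suc n)) - ?a / (?a + 1) * \<rho> \<noteq> 0"
  proof -
    have "?a \<noteq> 0" by (simp only: of_nat_eq_0_iff neg_equal_0_iff_equal)
    moreover have "?a + 1 \<noteq> 0" using n0 by simp
    ultimately have "?a / (?a + 1) * \<rho> \<noteq> 0" using \<rho>(1) by (simp only: mult_eq_0_iff divide_eq_0_iff) blast
    then show ?thesis by simp
  qed
  ultimately show ?case by blast
qed

text \<open>The reciprocal of \<open>s \<mapsto> gstar (-s)\<close>, with its removable singularities at the poles \<open>-1, -2, \<dots>\<close> filled in.\<close>
definition inv_gstar :: "complex \<Rightarrow> complex" where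
  "inv_gstar s = (if s \<in> \<int>\<^sub>\<le>\<^sub>0 - {0} then 0 else 1 / gstar (-s))"

lemma inv_gstar_tendsto:
  assumes "w \<in> \<int>\<^sub>\<le>\<^sub>0"
  shows "(inv_gstar \<longlongrightarrow> inv_gstar w) (at w)"
proof -
  \<comment> \<open>Every set of integers is closed in the plane, so near \<open>w\<close> no other
    exceptional point interferes.\<close>
  have "open (- (\<int>\<^sub>\<le>\<^sub>0 - {w}))"
    by (metis Diff_subset closed_def closed_subset_Ints nonpos_Ints_subset_Ints subset_trans)
  then have "\<forall>\<^sub>F s in nhds w. s \<in> - (\<int>\<^sub>\<le>\<^sub>0 - {w})"
    by (rule eventually_nhds_in_open) simp
  then have ev: "\<forall>\<^sub>F s in at w. 1 / gstar (-s) = inv_gstar s"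
    unfolding eventually_at_filter by eventually_elim (auto simp: inv_gstar_def)
  show ?thesis
  proof (cases "w = 0")
    case True
    have "((\<lambda>s. 1 / gstar (-s)) \<longlongrightarrow> 1 / 2) (at w)"
      unfolding True by (intro tendsto_intros gstar_tendsto_0) auto
    moreover have "inv_gstar w = 1 / 2" by (simp add: True inv_gstar_def gstar_def)
    ultimately show ?thesis using Lim_transform_eventually[OF _ ev] by metis
  next
    case False
    obtain n where n: "w = - of_nat n" using assms by (elim nonpos_Ints_cases')
    with False have "n \<ge> 1" by (cases n) auto
    then obtain \<rho> where \<rho>: "\<rho> \<noteq> 0" "((\<lambda>s. (s + of_nat n) * gstar (-s)) \<longlongrightarrow> \<rho>) (at w)"
      using gstar_simple_pole n by blast
    have "((\<lambda>s. (s + of_nat n) / ((s + of_nat n) * gstar (-s))) \<longlongrightarrow> (w + of_nat n) / \<rho>) (at w)"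
      using \<rho> by (intro tendsto_intros) auto
    moreover have "\<forall>\<^sub>F s in at w. (s + of_nat n) / ((s + of_nat n) * gstar (-s)) = inv_gstar s"
      using ev eventually_neq_at_within[of w w UNIV]
    proof eventually_elim
      case (elim s)
      then have "s + of_nat n \<noteq> 0" using n by (auto simp: add_eq_0_iff2)
      with elim show ?case by simp
    qed
    ultimately have "(inv_gstar \<longlongrightarrow> (w + of_nat n) / \<rho>) (at w)"
      by (rule Lim_transform_eventually)
    then show ?thesis using assms False n by (simp add: inv_gstar_def)
  qed
qed

text \<open>Riemann's theorem on removable singularities: continuity at the nonpositive integers is
  \<open>inv_gstar_tendsto\<close>, and only finitely many of them lie in the half-plane because it
  is bounded on the left.\<close>

lemma inv_gstar_holomorphic:
  assumes nz: "\<And>z. Re z < \<alpha> \<Longrightarrow> \<not> is_pole gstar z \<Longrightarrow> gstar z \<noteq> 0"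
  shows "inv_gstar holomorphic_on {s. Re s > - \<alpha>}"
proof (rule no_isolated_singularity'[where K = "{s. Re s > - \<alpha>} \<inter> \<int>\<^sub>\<le>\<^sub>0"])
  show "(inv_gstar \<longlongrightarrow> inv_gstar z) (at z within {s. - \<alpha> < Re s})"
    if "z \<in> {s. Re s > - \<alpha>} \<inter> \<int>\<^sub>\<le>\<^sub>0" for z
    using that inv_gstar_tendsto[of z] by (auto intro: tendsto_within_subset)
  show "open {s. Re s > - \<alpha>}" by (rule open_halfspace_Re_gt)
  show "finite ({s. Re s > - \<alpha>} \<inter> \<int>\<^sub>\<le>\<^sub>0)"
  proof -
    obtain N :: nat where N: "\<alpha> \<le> real N" using real_arch_simple by blast
    have "{s. Re s > - \<alpha>} \<inter> \<int>\<^sub>\<le>\<^sub>0 \<subseteq> (\<lambda>n. - of_nat n) ` {..<N}"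
      using N by (auto elim!: nonpos_Ints_cases')
    then show ?thesis by (rule finite_subset) simp
  qed
  have op: "open (- \<int>\<^sub>\<le>\<^sub>0 :: complex set)" by auto
  have hol: "(\<lambda>s. gstar (-s)) holomorphic_on - \<int>\<^sub>\<le>\<^sub>0" by (rule gstar_holomorphic) auto
  \<comment> \<open>The hypothesis speaks only of points that are not poles; away from the
    nonpositive integers this is ensured by holomorphy.\<close>
  have ne: "gstar (-s) \<noteq> 0" if "Re s > - \<alpha>" "s \<notin> \<int>\<^sub>\<le>\<^sub>0" for s
  proof (rule nz)
    show "Re (-s) < \<alpha>" using that by simp
    have "(\<lambda>s. gstar (-s)) \<circ> uminus holomorphic_on uminus ` (- \<int>\<^sub>\<le>\<^sub>0)"
      by (intro holomorphic_on_compose_gen[OF _ hol] holomorphic_intros) auto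
    then have "gstar holomorphic_on uminus ` (- \<int>\<^sub>\<le>\<^sub>0)"
      by (simp add: o_def)
    moreover have "open (uminus ` (- \<int>\<^sub>\<le>\<^sub>0) :: complex set)" using op by (rule open_negations)
    ultimately show "\<not> is_pole gstar (-s)"
      using that by (intro not_is_pole_holomorphic) auto
  qed
  have "(\<lambda>s. 1 / gstar (-s)) holomorphic_on {s. - \<alpha> < Re s} - {s. - \<alpha> < Re s} \<inter> \<int>\<^sub>\<le>\<^sub>0"
    using ne by (intro holomorphic_intros holomorphic_on_subset[OF hol]) auto
  then show "inv_gstar holomorphic_on {s. - \<alpha> < Re s} - {s. - \<alpha> < Re s} \<inter> \<int>\<^sub>\<le>\<^sub>0"
    by (rule holomorphic_transform) (auto simp: inv_gstar_def)
qed

text \<open>For large \<open>s\<close> write \<open>gstar (-s)\<close> as 1 + \<delta> with \<delta>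
  = 1/(2s) + E. Then 1 - 1/(1+\<delta>) is \<delta> up to a quadratic error, and replacing 1/(2s) by
  1/(2(s+A)) costs A/(2s(s+A)); every error is of order two. The remaining \<open>s\<close> form a
  compact set on which the function is continuous. The denominator \<open>1 + norm s ^ 2\<close>
  covers both ranges with one constant.\<close>

lemma resolvent_transform_bound:
  fixes a c A :: real
  assumes hol: "inv_gstar holomorphic_on {s. Re s > a}" and "a < c" "0 < c + A"
  obtains C where "C \<ge> 0"
    "\<And>s. Re s \<ge> c \<Longrightarrow> norm (1 - inv_gstar s - 1 / (2 * (s + of_real A))) \<le> C / (1 + norm s ^ 2)"
proof -
  define H where "H = (\<lambda>s. 1 - inv_gstar s - 1 / (2 * (s + of_real A)))"
  obtain C0 r0 where C0: "C0 \<ge> 0" "r0 \<ge> 1" and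
    asy: "\<And>s. Re s \<ge> c \<Longrightarrow> norm s \<ge> r0 \<Longrightarrow> norm (gstar (-s) - 1 - 1 / (2 * s)) \<le> C0 / norm s ^ 2"
    using gstar_asymp by blast
  \<comment> \<open>The summands serve, in turn, the asymptotic expansion, the exclusion of
    nonpositive integers from Re s >= c, the bound 1/2 on the norm of \<delta>, and the comparison
    of \<open>s + of_real A\<close> with \<open>s\<close>.\<close>
  define r where "r = r0 + \<bar>c\<bar> + 1 + 2 * C0 + 2 * \<bar>A\<bar>"
  \<comment> \<open>One summand for each error: E, the shift by A, and the quadratic term, where
    1/(1+\<delta>) costs the factor 2.\<close>
  define C1 where "C1 = C0 + \<bar>A\<bar> + 2 * (1/2 + C0) ^ 2"
  have C1: "C1 \<ge> 0" using C0 by (simp add: C1_def)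
  have large: "norm (H s) \<le> C1 / norm s ^ 2" if s: "Re s \<ge> c" "norm s \<ge> r" for s
  proof -
    have r: "norm s \<ge> r0" "norm s \<ge> 1" "norm s > \<bar>c\<bar>" "norm s \<ge> 1 + 2 * C0" "norm s \<ge> 2 * \<bar>A\<bar>"
      using s C0 by (auto simp: r_def)
    have s0: "s \<noteq> 0" using r by auto
    have "s \<notin> \<int>\<^sub>\<le>\<^sub>0" using s r by (auto elim!: nonpos_Ints_cases')
    then have J: "inv_gstar s = 1 / gstar (-s)" by (simp add: inv_gstar_def)
    define E where "E = gstar (-s) - 1 - 1 / (2 * s)"
    have E: "norm E \<le> C0 / norm s ^ 2" unfolding E_def using s r by (intro asy) auto
    define \<delta> where "\<delta> = 1 / (2 * s) + E"
    have "norm \<delta> \<le> norm (1 / (2 * s)) + norm E" unfolding \<delta>_def by (rule norm_triangle_ineq)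
    also have "norm (1 / (2 * s)) = (1/2) / norm s" by (simp add: norm_divide norm_mult)
    also have "norm E \<le> C0 / norm s"
    proof (rule order_trans[OF E])
      have "norm s * 1 \<le> norm s * norm s" using r by (intro mult_left_mono) auto
      then show "C0 / norm s ^ 2 \<le> C0 / norm s"
        using C0 s0 by (intro divide_left_mono) (auto simp: power2_eq_square)
    qed
    finally have \<delta>: "norm \<delta> \<le> (1/2 + C0) / norm s" by (simp add: add_divide_distrib)
    also have "\<dots> \<le> 1 / 2" using r by (subst pos_divide_le_eq) auto
    finally have "norm \<delta> \<le> 1 / 2" .
    then have \<delta>1: "norm (1 + \<delta>) \<ge> 1 / 2" using norm_diff_ineq[of 1 \<delta>] by simp
    have ne: "1 + \<delta> \<noteq> 0" using \<delta>1 by auto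
    have sA: "norm (s + of_real A) \<ge> norm s / 2"
      using norm_diff_ineq[of s "of_real A"] r by simp
    have sA0: "s + of_real A \<noteq> 0" using sA s0 by auto
    have "H s = 1 - 1 / (1 + \<delta>) - 1 / (2 * (s + of_real A))"
      by (simp add: H_def J \<delta>_def E_def)
    also have "1 - 1 / (1 + \<delta>) = \<delta> - \<delta>\<^sup>2 / (1 + \<delta>)"
      using ne by (simp add: field_simps power2_eq_square)
    finally have H1: "H s = \<delta> - \<delta>\<^sup>2 / (1 + \<delta>) - 1 / (2 * (s + of_real A))" .
    have "1 / (2 * s) = 1 / (2 * (s + of_real A)) + of_real A / (2 * (s * (s + of_real A)))"
    proof -
      have "1 / (2 * u) = 1 / (2 * v) + x / (2 * (u * v))"
        if "u \<noteq> 0" "v \<noteq> 0" "v = u + x" for u v x :: complex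
        using that(1,2) by (simp add: field_simps) (simp add: that(3) algebra_simps)
      then show ?thesis using s0 sA0 by blast
    qed
    then have "\<delta> - \<delta>\<^sup>2 / (1 + \<delta>) - 1 / (2 * (s + of_real A)) =
       E + of_real A / (2 * (s * (s + of_real A))) - \<delta>\<^sup>2 / (1 + \<delta>)"
      by (simp add: \<delta>_def)
    with H1 have "norm (H s) = norm (E + of_real A / (2 * (s * (s + of_real A))) - \<delta>\<^sup>2 / (1 + \<delta>))"
      by (simp only:)
    also have "\<dots> \<le> norm E + norm (of_real A / (2 * (s * (s + of_real A)))) + norm (\<delta>\<^sup>2 / (1 + \<delta>))"
      using norm_triangle_ineq4[of "E + of_real A / (2 * (s * (s + of_real A)))" "\<delta>\<^sup>2 / (1 + \<delta>)"]
        norm_triangle_ineq[of E "of_real A / (2 * (s * (s + of_real A)))"] by linarith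
    also note E
    also have "norm (of_real A / (2 * (s * (s + of_real A)))) \<le> \<bar>A\<bar> / norm s ^ 2"
    proof -
      have "norm (of_real A / (2 * (s * (s + of_real A)))) = \<bar>A\<bar> / (2 * (norm s * norm (s + of_real A)))"
        by (simp add: norm_divide norm_mult)
      also have "\<dots> \<le> \<bar>A\<bar> / (2 * (norm s * (norm s / 2)))"
        using sA s0 sA0 by (intro divide_left_mono mult_left_mono mult_pos_pos) auto
      finally show ?thesis by (simp add: power2_eq_square)
    qed
    also have "norm (\<delta>\<^sup>2 / (1 + \<delta>)) \<le> 2 * (1/2 + C0) ^ 2 / norm s ^ 2"
    proof -
      have "norm (\<delta>\<^sup>2 / (1 + \<delta>)) = norm \<delta> ^ 2 / norm (1 + \<delta>)" by (simp add: norm_divide norm_power)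
      also have "\<dots> \<le> ((1/2 + C0) / norm s) ^ 2 / (1 / 2)"
        using \<delta> \<delta>1 by (intro frac_le power_mono) auto
      finally show ?thesis by (simp add: power_divide mult.commute)
    qed
    finally show ?thesis by (simp add: C1_def add_divide_distrib)
  qed
  have "compact (cball 0 r \<inter> {s. Re s \<ge> c})"
    by (intro compact_Int_closed closed_halfspace_Re_ge compact_cball)
  moreover have "continuous_on (cball 0 r \<inter> {s. Re s \<ge> c}) H"
  proof -
    have "2 * (s + of_real A) \<noteq> 0" if "Re s \<ge> c" for s
      using that assms(3) by (auto simp: complex_eq_iff)
    then show ?thesis
      unfolding H_def using \<open>a < c\<close>
      by (intro continuous_intros continuous_on_subset[OF holomorphic_on_imp_continuous_on[OF hol]]) auto
  qed
  ultimately have "bounded (H ` (cball 0 r \<inter> {s. Re s \<ge> c}))"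
    by (intro compact_imp_bounded compact_continuous_image)
  then obtain B where B: "B > 0" "\<And>s. norm s \<le> r \<Longrightarrow> Re s \<ge> c \<Longrightarrow> norm (H s) \<le> B"
    by (auto simp: bounded_pos)
  have r1: "r \<ge> 1" using C0 by (simp add: r_def)
  show ?thesis
  proof (rule that)
    \<comment> \<open>The first summand handles norms at least \<open>r\<close>, where 1 + |s|^2 is
      at most 2|s|^2; the second handles the compact part.\<close>
    show "2 * C1 + B * (1 + r\<^sup>2) \<ge> 0" using B C1 by simp
    fix s assume s: "Re s \<ge> c"
    have pos: "0 < 1 + norm s ^ 2" by (simp add: add_pos_nonneg)
    have "norm (H s) \<le> (2 * C1 + B * (1 + r\<^sup>2)) / (1 + norm s ^ 2)"
    proof (cases "norm s \<ge> r")
      case True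
      with r1 have "1 \<le> norm s" by simp
      then have *: "1 + norm s ^ 2 \<le> 2 * norm s ^ 2" "0 < norm s ^ 2" by auto
      have "norm (H s) \<le> C1 / norm s ^ 2" using large s True by simp
      also have "\<dots> = 2 * C1 / (2 * norm s ^ 2)" by simp
      also have "\<dots> \<le> (2 * C1 + B * (1 + r\<^sup>2)) / (1 + norm s ^ 2)"
        using * C1 B pos by (intro frac_le) auto
      finally show ?thesis .
    next
      case False
      then have "norm (H s) \<le> B" using B s by simp
      also have "B * (1 + norm s ^ 2) \<le> 2 * C1 + B * (1 + r\<^sup>2)"
      proof -
        have "norm s ^ 2 \<le> r\<^sup>2" using False by (intro power_mono) auto
        then have "B * (1 + norm s ^ 2) \<le> B * (1 + r\<^sup>2)" using B by (intro mult_left_mono) auto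
        then show ?thesis using C1 by linarith
      qed
      then have "B \<le> (2 * C1 + B * (1 + r\<^sup>2)) / (1 + norm s ^ 2)"
        using pos by (simp add: pos_le_divide_eq)
      finally show ?thesis .
    qed
    then show "norm (1 - inv_gstar s - 1 / (2 * (s + of_real A))) \<le> (2 * C1 + B * (1 + r\<^sup>2)) / (1 + norm s ^ 2)"
      by (simp add: H_def)
  qed
qed

section \<open>Mellin transforms and their inversion\<close>

lemma integrable_inverse_1_plus_square:
  "integrable lborel (\<lambda>t::real. 1 / (1 + t\<^sup>2))"
proof -
  have pos: "1 + t\<^sup>2 > 0" for t :: real by (simp add: add_pos_nonneg)
  have "(\<integral>\<^sup>+t. ennreal (1 / (1 + t\<^sup>2)) * indicator {0..} t \<partial>lborel) = pi / 2 - arctan 0"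
  proof (rule nn_integral_FTC_atLeast)
    show "DERIV arctan t :> 1 / (1 + t\<^sup>2)" for t
      using DERIV_arctan[of t] by (simp add: divide_inverse)
  qed (use pos in \<open>auto intro!: tendsto_arctan_at_top less_imp_le\<close>)
  then have "has_bochner_integral lborel (\<lambda>t::real. indicator {0..} t *\<^sub>R (1 / (1 + t\<^sup>2))) (pi / 2)"
    using pos by (intro has_bochner_integral_nn_integral)
      (auto simp: less_imp_le indicator_mult_ennreal mult.commute intro!: AE_I2 mult_nonneg_nonneg)
  from has_bochner_integral_even_function[OF this] show ?thesis
    by (auto intro: has_bochner_integral_integrable integrable.intros)
qed

lemma set_integrable_powr_at_top:
  assumes "e < (-1::real)"
  shows "set_integrable lborel {1<..} (\<lambda>y. y powr e)"
proof -
  have "(\<integral>\<^sup>+y. ennreal (y powr e) * indicator {1..} y \<partial>lborel) = ennreal (0 - 1 powr (e + 1) / (e + 1))"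
  proof (rule nn_integral_FTC_atLeast[where F = "\<lambda>y. y powr (e + 1) / (e + 1)"])
    show "DERIV (\<lambda>y. y powr (e + 1) / (e + 1)) y :> y powr e" if "1 \<le> y" for y
      using that assms by (auto intro!: derivative_eq_intros)
    have "((\<lambda>y. y powr (e + 1) / (e + 1)) \<longlongrightarrow> 0 / (e + 1)) at_top"
      using assms by (intro tendsto_divide tendsto_neg_powr filterlim_ident) auto
    then show "((\<lambda>y. y powr (e + 1) / (e + 1)) \<longlongrightarrow> 0) at_top" by simp
  qed auto
  also have "\<dots> < \<infinity>" by simp
  finally have "(\<integral>\<^sup>+y. ennreal (norm (indicator {1..} y *\<^sub>R (y powr e))) \<partial>lborel) < \<infinity>"
    by (simp add: ennreal_mult' ennreal_indicator abs_mult mult.commute)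
  then have "set_integrable lborel {1..} (\<lambda>y. y powr e)"
    unfolding set_integrable_def by (intro integrableI_bounded) auto
  then show ?thesis by (rule set_integrable_subset) auto
qed

lemma set_integral_complex_powr_at_top:
  assumes "Re w < -1"
  shows "set_integrable lborel {1<..} (\<lambda>y. complex_of_real y powr w)"
    and "(LINT y:{1<..}|lborel. complex_of_real y powr w) = - 1 / (w + 1)"
proof -
  have ei: "einterval (ereal 1) \<infinity> = {1<..}" by (auto simp: einterval_def)
  have w: "w + 1 \<noteq> 0" using assms by (auto simp: complex_eq_iff)
  show int: "set_integrable lborel {1<..} (\<lambda>y. complex_of_real y powr w)"
  proof (rule set_integrable_bound[OF set_integrable_powr_at_top[OF assms]])
    have "(\<lambda>y. indicator {1<..} y *\<^sub>R complex_of_real y powr w) \<in> borel_measurable borel"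
      by (intro borel_measurable_continuous_on_indicator continuous_intros) auto
    then show "set_borel_measurable lborel {1<..} (\<lambda>y. complex_of_real y powr w)"
      by (simp add: set_borel_measurable_def)
  qed (auto simp: norm_powr_real_powr)
  have "(LBINT y=ereal 1..\<infinity>. complex_of_real y powr w) = 0 - 1 / (w + 1)"
  proof (rule interval_integral_FTC_integrable)
    show "((\<lambda>y. complex_of_real y powr (w + 1) / (w + 1)) has_vector_derivative of_real y powr w) (at y)"
      if "ereal 1 < ereal y" for y
    proof -
      have "y > 0" using that by simp
      then have "((\<lambda>z. z powr (w + 1) / (w + 1)) has_field_derivative of_real y powr w) (at (of_real y))"
        using w by (auto intro!: derivative_eq_intros simp: complex_nonpos_Reals_iff)
      from has_vector_derivative_real_field[OF this] show ?thesis .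
    qed
    show "isCont (\<lambda>y. complex_of_real y powr w) y" if "ereal 1 < ereal y" for y
      using that by (auto intro!: continuous_intros simp: complex_nonpos_Reals_iff)
    show "set_integrable lborel (einterval (ereal 1) \<infinity>) (\<lambda>y. complex_of_real y powr w)"
      using int by (simp add: ei)
    have "isCont (\<lambda>y. complex_of_real y powr (w + 1) / (w + 1)) 1"
      using w by (auto intro!: continuous_intros simp: complex_nonpos_Reals_iff)
    then have "((\<lambda>y. complex_of_real y powr (w + 1) / (w + 1)) \<longlongrightarrow> of_real 1 powr (w + 1) / (w + 1)) (at_right 1)"
      by (auto simp: isCont_def intro: tendsto_within_subset)
    then show "(((\<lambda>y. complex_of_real y powr (w + 1) / (w + 1)) \<circ> real_of_ereal) \<longlongrightarrow> 1 / (w + 1)) (at_right (ereal 1))"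
      by (simp add: ereal_tendsto_simps)
    have "((\<lambda>y. y powr (Re w + 1) / norm (w + 1)) \<longlongrightarrow> 0 / norm (w + 1)) at_top"
      using assms w by (intro tendsto_divide tendsto_neg_powr filterlim_ident tendsto_const) auto
    moreover have "\<forall>\<^sub>F y in at_top. norm (complex_of_real y powr (w + 1) / (w + 1)) = y powr (Re w + 1) / norm (w + 1)"
      using eventually_gt_at_top[of 0]
      by eventually_elim (auto simp: norm_divide norm_powr_real_powr)
    ultimately have "((\<lambda>y. norm (complex_of_real y powr (w + 1) / (w + 1))) \<longlongrightarrow> 0) at_top"
      by (simp add: tendsto_cong)
    then have "((\<lambda>y. complex_of_real y powr (w + 1) / (w + 1)) \<longlongrightarrow> 0) at_top"
      by (rule tendsto_norm_zero_cancel)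
    then show "(((\<lambda>y. complex_of_real y powr (w + 1) / (w + 1)) \<circ> real_of_ereal) \<longlongrightarrow> 0) (at_left \<infinity>)"
      by (simp add: ereal_tendsto_simps)
  qed auto
  then show "(LINT y:{1<..}|lborel. complex_of_real y powr w) = - 1 / (w + 1)"
    by (simp add: interval_lebesgue_integral_def ei)
qed

lemma continuous_on_vertical_line:
  assumes "H holomorphic_on {s. Re s > a}" and "a < c"
  shows "continuous_on UNIV (\<lambda>t. H (Complex c t))"
  unfolding Complex_eq using assms(2)
  by (intro continuous_on_compose2[OF holomorphic_on_imp_continuous_on[OF assms(1)]] continuous_intros) auto

lemma vertical_line_bound:
  assumes "C \<ge> 0" and bd: "\<And>s. Re s \<ge> c \<Longrightarrow> norm (H s) \<le> C / (1 + norm s ^ 2)"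
  shows "norm (H (Complex c t)) \<le> C / (1 + t\<^sup>2)"
proof -
  have "norm (H (Complex c t)) \<le> C / (1 + norm (Complex c t) ^ 2)" by (rule bd) simp
  also have "\<dots> \<le> C / (1 + t\<^sup>2)"
    using assms(1) by (intro divide_left_mono mult_pos_pos add_pos_nonneg) (auto simp: cmod_power2)
  finally show ?thesis .
qed

text \<open>Apply Cauchy's formula to the rectangle with left side from c - iT to c + iT and width
  T. On the other three sides the integrand is O(T^-3) and the lengths are at most 2T, so only the
  left side survives as T grows.\<close>

lemma Cauchy_half_plane:
  fixes H :: "complex \<Rightarrow> complex" and a c m C :: real
  assumes hol: "H holomorphic_on {s. Re s > a}" and ac: "a < c" "c < m" and C: "C \<ge> 0"
    and bd: "\<And>s. Re s \<ge> c \<Longrightarrow> norm (H s) \<le> C / (1 + norm s ^ 2)"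
  shows "integrable lborel (\<lambda>t. H (Complex c t) / (of_real m - Complex c t))"
    and "(\<integral>t. H (Complex c t) / (of_real m - Complex c t) \<partial>lborel) = 2 * pi * H (of_real m)"
proof -
  define f where "f = (\<lambda>w. H w / (w - of_real m))"
  define g where "g = (\<lambda>t. H (Complex c t) / (of_real m - Complex c t))"
  have Hc: "continuous_on UNIV (\<lambda>t. H (Complex c t))"
    by (rule continuous_on_vertical_line[OF hol ac(1)])
  have nz: "of_real m - Complex c t \<noteq> 0" for t using ac by (auto simp: complex_eq_iff)
  have gc: "continuous_on UNIV g"
    unfolding g_def using nz by (intro continuous_intros Hc) (auto simp: Complex_eq intro!: continuous_intros)
  have gb: "norm (g t) \<le> C / (m - c) * (1 / (1 + t\<^sup>2))" for t
  proof -
    have 1: "norm (H (Complex c t)) \<le> C / (1 + t\<^sup>2)" by (rule vertical_line_bound[OF C bd])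
    have 2: "m - c \<le> norm (of_real m - Complex c t)"
      using complex_Re_le_cmod[of "of_real m - Complex c t"] by simp
    have "norm (g t) \<le> (C / (1 + t\<^sup>2)) / (m - c)"
      unfolding g_def norm_divide using 1 2 C ac by (intro frac_le) auto
    then show ?thesis by (simp add: mult.commute)
  qed
  have gi: "integrable lborel g"
  proof (rule Bochner_Integration.integrable_bound)
    show "integrable lborel (\<lambda>t. C / (m - c) * (1 / (1 + t\<^sup>2)))"
      by (intro integrable_mult_right integrable_inverse_1_plus_square)
    show "g \<in> borel_measurable lborel" using gc by (simp add: borel_measurable_continuous_onI)
    show "AE t in lborel. norm (g t) \<le> norm (C / (m - c) * (1 / (1 + t\<^sup>2)))"
      by (intro AE_I2 order_trans[OF gb]) (simp only: real_norm_def abs_ge_self)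
  qed
  then show "integrable lborel (\<lambda>t. H (Complex c t) / (of_real m - Complex c t))"
    by (simp add: g_def)

  \<comment> \<open>The conditions on \<open>T\<close> put the three far sides at distance at least
    T/2 from both 0 and \<open>m\<close>. Each then contributes at most (8C/T^3) times 2T, that is
    16C/T^2.\<close>
  have fint: "norm (integral {-T..T} g - 2 * pi * H (of_real m)) \<le> 48 * C / T\<^sup>2"
    if T: "T > 0" "T \<ge> 2 * \<bar>c\<bar>" "T \<ge> 2 * (m - c)" for T
  proof -
    define a1 a2 a3 a4 where "a1 = Complex c (-T)" and "a2 = Complex (c + T) (-T)"
      and "a3 = Complex (c + T) T" and "a4 = Complex c T"
    note as = a1_def a2_def a3_def a4_def
    have rp: "rectpath a1 a3 = linepath a1 a2 +++ linepath a2 a3 +++ linepath a3 a4 +++ linepath a4 a1"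
      by (simp add: rectpath_def Let_def as)
    have box: "of_real m \<in> box a1 a3" using T ac by (simp add: as in_box_complex_iff)
    have pim: "path_image (rectpath a1 a3) \<subseteq> {s. Re s > a} - {of_real m}"
      using T ac by (subst path_image_rectpath) (auto simp: as)
    have "(f has_contour_integral (2 * pi * \<i> * winding_number (rectpath a1 a3) (of_real m) * H (of_real m)))
        (rectpath a1 a3)"
      unfolding f_def using pim ac
      by (intro Cauchy_integral_formula_convex_simple[OF _ hol] convex_halfspace_Re_gt)
         (auto simp: interior_open open_halfspace_Re_gt)
    then have hc: "(f has_contour_integral (2 * pi * \<i> * H (of_real m))) (rectpath a1 a3)"
      by (simp add: winding_number_rectpath[OF box])
    then have fi: "f contour_integrable_on (rectpath a1 a3)" by (auto simp: contour_integrable_on_def)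
    have i1: "f contour_integrable_on linepath a1 a2" "f contour_integrable_on linepath a2 a3"
       "f contour_integrable_on linepath a3 a4" "f contour_integrable_on linepath a4 a1"
      using fi unfolding rp by (simp_all add: valid_path_join)
    have sum: "2 * pi * \<i> * H (of_real m) = contour_integral (linepath a1 a2) f + (contour_integral (linepath a2 a3) f
        + (contour_integral (linepath a3 a4) f + contour_integral (linepath a4 a1) f))"
      using contour_integral_unique[OF hc] i1 unfolding rp
      by (simp add: valid_path_join contour_integrable_joinI)
    have fb: "norm (f w) \<le> 8 * C / T ^ 3" if w: "Re w \<ge> c" "norm w \<ge> T / 2" "norm (w - of_real m) \<ge> T / 2" for w
    proof -
      have "norm (H w) \<le> C / (1 + norm w ^ 2)" using w by (intro bd)
      also have "\<dots> \<le> C / (T / 2)\<^sup>2"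
      proof (intro divide_left_mono C)
        have "(T / 2)\<^sup>2 \<le> norm w ^ 2" using w T by (intro power_mono) auto
        then show "(T / 2)\<^sup>2 \<le> 1 + norm w ^ 2" by simp
      qed (use T in \<open>auto intro!: mult_pos_pos add_pos_nonneg\<close>)
      finally have "norm (f w) \<le> C / (T / 2)\<^sup>2 / (T / 2)"
        unfolding f_def norm_divide using w T C by (intro frac_le) auto
      then show ?thesis by (simp add: power2_eq_square power3_eq_cube field_simps)
    qed
    have B0: "0 \<le> 8 * C / T ^ 3" using C T by simp
    have n1: "norm (contour_integral (linepath a1 a2) f) \<le> 8 * C / T ^ 3 * norm (a2 - a1)"
    proof (rule contour_integral_bound_linepath[OF i1(1) B0 fb])
      fix w assume "w \<in> closed_segment a1 a2"
      then have w: "Im w = -T" "Re w \<ge> c"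
        using T by (auto simp: as closed_segment_same_Im closed_segment_eq_real_ivl)
      show "Re w \<ge> c" by fact
      show "norm w \<ge> T / 2" "norm (w - of_real m) \<ge> T / 2"
        using abs_Im_le_cmod[of w] abs_Im_le_cmod[of "w - of_real m"] w T by auto
    qed
    have n3: "norm (contour_integral (linepath a3 a4) f) \<le> 8 * C / T ^ 3 * norm (a4 - a3)"
    proof (rule contour_integral_bound_linepath[OF i1(3) B0 fb])
      fix w assume "w \<in> closed_segment a3 a4"
      then have w: "Im w = T" "Re w \<ge> c"
        using T by (auto simp: as closed_segment_same_Im closed_segment_eq_real_ivl)
      show "Re w \<ge> c" by fact
      show "norm w \<ge> T / 2" "norm (w - of_real m) \<ge> T / 2"
        using abs_Im_le_cmod[of w] abs_Im_le_cmod[of "w - of_real m"] w T by auto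
    qed
    have n2: "norm (contour_integral (linepath a2 a3) f) \<le> 8 * C / T ^ 3 * norm (a3 - a2)"
    proof (rule contour_integral_bound_linepath[OF i1(2) B0 fb])
      fix w assume "w \<in> closed_segment a2 a3"
      then have w: "Re w = c + T"
        using T by (auto simp: as closed_segment_same_Re)
      show "Re w \<ge> c" using w T by simp
      show "norm w \<ge> T / 2" "norm (w - of_real m) \<ge> T / 2"
        using abs_Re_le_cmod[of w] abs_Re_le_cmod[of "w - of_real m"] w T by auto
    qed
    have len: "norm (a2 - a1) \<le> 2 * T" "norm (a3 - a2) \<le> 2 * T" "norm (a4 - a3) \<le> 2 * T"
      using T by (auto simp: as cmod_def real_sqrt_mult)
    have e: "8 * C / T ^ 3 * (2 * T) = 16 * C / T\<^sup>2"
      using T by (simp add: power2_eq_square power3_eq_cube)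
    have n: "norm (contour_integral (linepath a1 a2) f) \<le> 16 * C / T\<^sup>2" 
      "norm (contour_integral (linepath a2 a3) f) \<le> 16 * C / T\<^sup>2"
      "norm (contour_integral (linepath a3 a4) f) \<le> 16 * C / T\<^sup>2"
      using n1 n2 n3 mult_left_mono[OF len(1) B0] mult_left_mono[OF len(2) B0] mult_left_mono[OF len(3) B0] 
      unfolding e by linarith+
    \<comment> \<open>The left side is traversed downwards, and there \<open>f\<close> is
      \<open>-g\<close>; the two signs cancel.\<close>
    have "contour_integral (linepath a4 a1) f = - contour_integral (linepath a1 a4) f"
      using contour_integral_reversepath[of "linepath a1 a4" f] by simp
    also have "contour_integral (linepath a1 a4) f = \<i> * integral {-T..T} (\<lambda>x. f (Complex c x))"
      using T by (intro contour_integral_linepath_same_Re) (auto simp: as)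
    also have "(\<lambda>x. f (Complex c x)) = (\<lambda>x. - g x)"
    proof
      fix x 
      have "Complex c x - of_real m = - (of_real m - Complex c x)" by simp
      then show "f (Complex c x) = - g x" unfolding f_def g_def by (simp only: divide_minus_right)
    qed
    finally have "contour_integral (linepath a4 a1) f = \<i> * integral {-T..T} g" by simp
    with sum have "\<i> * (integral {-T..T} g - 2 * pi * H (of_real m)) =
       - (contour_integral (linepath a1 a2) f + (contour_integral (linepath a2 a3) f + contour_integral (linepath a3 a4) f))"
      by (simp add: algebra_simps)
    then have "norm (\<i> * (integral {-T..T} g - 2 * pi * H (of_real m))) =
       norm (contour_integral (linepath a1 a2) f + (contour_integral (linepath a2 a3) f + contour_integral (linepath a3 a4) f))"
      by (simp only: norm_minus_cancel)
    also have "\<dots> \<le> 16 * C / T\<^sup>2 + (16 * C / T\<^sup>2 + 16 * C / T\<^sup>2)"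
      using n by (intro norm_triangle_le add_mono norm_triangle_mono) auto
    finally show ?thesis by (simp add: norm_mult)
  qed
  have "(\<lambda>n. integral {-real n..real n} g) \<longlonglongrightarrow> 2 * pi * H (of_real m)"
  proof (rule LIM_zero_cancel, rule Lim_null_comparison)
    show "\<forall>\<^sub>F n in sequentially. norm (integral {-real n..real n} g - 2 * pi * H (of_real m)) \<le> 48 * C * inverse (real n ^ 2)"
      using eventually_gt_at_top[of 0] eventually_ge_at_top[of "nat \<lceil>2 * \<bar>c\<bar>\<rceil>"] eventually_ge_at_top[of "nat \<lceil>2 * (m - c)\<rceil>"]
    proof eventually_elim
      case (elim n)
      then show ?case using fint[of "real n"] by (simp add: divide_inverse)
    qed
    have "(\<lambda>n. 48 * C * inverse (real n) ^ 2) \<longlonglongrightarrow> 48 * C * 0 ^ 2"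
      by (intro tendsto_intros lim_inverse_n)
    then show "(\<lambda>n. 48 * C * inverse (real n ^ 2)) \<longlonglongrightarrow> 0" by (simp add: power_inverse)
  qed
  moreover have "(\<lambda>n. integral {-real n..real n} g) \<longlonglongrightarrow> (\<integral>t. g t \<partial>lborel)"
  proof -
    have "(\<lambda>n. \<integral>t. indicator {-real n..real n} t *\<^sub>R g t \<partial>lborel) \<longlonglongrightarrow> (\<integral>t. g t \<partial>lborel)"
    proof (rule integral_dominated_convergence)
      show "integrable lborel (\<lambda>t. norm (g t))" using gi by simp
      show "AE t in lborel. (\<lambda>n. indicator {-real n..real n} t *\<^sub>R g t) \<longlonglongrightarrow> g t"
      proof (intro AE_I2 tendsto_eventually)
        fix t :: real
        show "\<forall>\<^sub>F n in sequentially. indicator {-real n..real n} t *\<^sub>R g t = g t"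
          using eventually_ge_at_top[of "nat \<lceil>\<bar>t\<bar>\<rceil>"] 
          by eventually_elim (auto simp: indicator_def)
      qed
    qed (use gi in \<open>auto simp: indicator_def\<close>)
    moreover have "(\<integral>t. indicator {-real n..real n} t *\<^sub>R g t \<partial>lborel) = integral {-real n..real n} g" for n
      using set_borel_integral_eq_integral(2)[of "{-real n..real n}" g]
        borel_integrable_atLeastAtMost'[OF continuous_on_subset[OF gc]]
      by (simp add: set_lebesgue_integral_def)
    ultimately show ?thesis by simp
  qed
  ultimately have "(\<integral>t. g t \<partial>lborel) = 2 * pi * H (of_real m)"
    using LIMSEQ_unique by blast
  then show "(\<integral>t. H (Complex c t) / (of_real m - Complex c t) \<partial>lborel) = 2 * pi * H (of_real m)"
    by (simp add: g_def)
qed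

section \<open>The Mellin transform and its inverse along a vertical line\<close>

text \<open>Real arguments are enough because functions are later identified by the values of their
  transforms at integers. The measure dy/y is absorbed in the exponent.\<close>

definition mellin :: "(real \<Rightarrow> complex) \<Rightarrow> real \<Rightarrow> complex" where
  "mellin f m = (LINT y:{1<..}|lborel. f y * of_real (y powr (- m - 1)))"

text \<open>The factor multiplying \<open>H\<close> is \<open>y\<^sup>s\<close> at \<open>s = c + \<i>t\<close>.\<close>
definition mellin_inv :: "real \<Rightarrow> (complex \<Rightarrow> complex) \<Rightarrow> real \<Rightarrow> complex" where
  "mellin_inv c H y = of_real (y powr c) / (2 * pi) * (\<integral>t. H (Complex c t) * cis (t * ln y) \<partial>lborel)"

lemma borel_measurable_cis [measurable]: "cis \<in> borel_measurable borel"
  by (intro borel_measurable_continuous_onI continuous_intros)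

lemma integrable_vertical_line:
  assumes cont: "continuous_on UNIV (\<lambda>t. H (Complex c t))"
    and bd: "\<And>t. norm (H (Complex c t)) \<le> C / (1 + t\<^sup>2)"
  shows "integrable lborel (\<lambda>t. H (Complex c t) * cis (t * u))"
proof (rule Bochner_Integration.integrable_bound)
  show "integrable lborel (\<lambda>t. C * (1 / (1 + t\<^sup>2)))"
    by (intro integrable_mult_right integrable_inverse_1_plus_square)
  have [measurable]: "(\<lambda>t. H (Complex c t)) \<in> borel_measurable borel"
    using cont by (rule borel_measurable_continuous_onI)
  show "(\<lambda>t. H (Complex c t) * cis (t * u)) \<in> borel_measurable lborel" by measurable
  show "AE t in lborel. norm (H (Complex c t) * cis (t * u)) \<le> norm (C * (1 / (1 + t\<^sup>2)))"
  proof (intro AE_I2)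
    fix t :: real
    have "norm (H (Complex c t) * cis (t * u)) \<le> C * (1 / (1 + t\<^sup>2))"
      using bd[of t] by (simp add: norm_mult)
    also have "\<dots> \<le> norm (C * (1 / (1 + t\<^sup>2)))" unfolding real_norm_def by (rule abs_ge_self)
    finally show "norm (H (Complex c t) * cis (t * u)) \<le> norm (C * (1 / (1 + t\<^sup>2)))" .
  qed
qed

lemma mellin_inv_bound:
  assumes cont: "continuous_on UNIV (\<lambda>t. H (Complex c t))"
    and bd: "\<And>t. norm (H (Complex c t)) \<le> C / (1 + t\<^sup>2)"
  obtains K where "K \<ge> 0" "\<And>y. norm (mellin_inv c H y) \<le> K * y powr c"
proof -
  let ?I = "\<integral>t. norm (H (Complex c t)) \<partial>lborel"
  show ?thesis
  proof (rule that)
    show "?I / (2 * pi) \<ge> 0" by simp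
    fix y :: real
    have "norm (\<integral>t. H (Complex c t) * cis (t * ln y) \<partial>lborel) \<le> (\<integral>t. norm (H (Complex c t) * cis (t * ln y)) \<partial>lborel)"
      by (rule integral_norm_bound)
    also have "\<dots> = ?I" by (simp add: norm_mult)
    finally have "y powr c / (2 * pi) * norm (\<integral>t. H (Complex c t) * cis (t * ln y) \<partial>lborel) \<le> y powr c / (2 * pi) * ?I"
      by (intro mult_left_mono) auto
    then show "norm (mellin_inv c H y) \<le> ?I / (2 * pi) * y powr c"
      by (simp add: mellin_inv_def norm_mult norm_divide mult_ac)
  qed
qed

lemma mellin_inv_continuous:
  assumes cont: "continuous_on UNIV (\<lambda>t. H (Complex c t))"
    and bd: "\<And>t. norm (H (Complex c t)) \<le> C / (1 + t\<^sup>2)"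
  shows "continuous_on {1..} (mellin_inv c H)"
proof -
  have [measurable]: "(\<lambda>t. H (Complex c t)) \<in> borel_measurable borel"
    using cont by (rule borel_measurable_continuous_onI)
  have "continuous_on UNIV cis" by (intro continuous_intros)
  then have cis: "isCont cis z" for z by (simp add: continuous_on_eq_continuous_at)
  have "continuous_on {1..} (\<lambda>y. \<integral>t. H (Complex c t) * cis (t * ln y) \<partial>lborel)"
    unfolding continuous_on_sequentially
  proof (intro allI ballI impI, elim conjE)
    fix x :: "nat \<Rightarrow> real" and a :: real
    assume a: "a \<in> {1..}" "\<forall>n. x n \<in> {1..}" "x \<longlonglongrightarrow> a"
    show "((\<lambda>y. \<integral>t. H (Complex c t) * cis (t * ln y) \<partial>lborel) \<circ> x) \<longlonglongrightarrow>
        (\<integral>t. H (Complex c t) * cis (t * ln a) \<partial>lborel)"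
      unfolding o_def
    proof (rule integral_dominated_convergence)
      show "integrable lborel (\<lambda>t. norm (H (Complex c t)))"
        using integrable_vertical_line[where u = 0, OF assms] by simp
      show "AE t in lborel. (\<lambda>n. H (Complex c t) * cis (t * ln (x n))) \<longlonglongrightarrow> H (Complex c t) * cis (t * ln a)"
        using a by (intro AE_I2 tendsto_mult tendsto_const isCont_tendsto_compose[OF cis] tendsto_ln) auto
    qed (auto simp: norm_mult)
  qed
  then show ?thesis
    unfolding mellin_inv_def[abs_def] by (intro continuous_intros) auto
qed

text \<open>Integrating over y first turns y^(s-m-1) into the Cauchy kernel 1/(m-s), and
  \<open>Cauchy_half_plane\<close> evaluates what is left. The exchange is justified by c < m: the
  double integral is dominated by the product of the norm of \<open>h\<close> and a power of y with
  exponent c - m - 1 < -1.\<close>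

lemma mellin_mellin_inv:
  fixes H :: "complex \<Rightarrow> complex" and a c m C :: real
  assumes hol: "H holomorphic_on {s. Re s > a}" and ac: "a < c" "c < m" and C: "C \<ge> 0"
    and bd: "\<And>s. Re s \<ge> c \<Longrightarrow> norm (H s) \<le> C / (1 + norm s ^ 2)"
  shows "mellin (mellin_inv c H) m = H (of_real m)"
proof -
  define h where "h = (\<lambda>t. H (Complex c t))"
  have cont: "continuous_on UNIV h"
    unfolding h_def by (rule continuous_on_vertical_line[OF hol ac(1)])
  have hb: "norm (h t) \<le> C / (1 + t\<^sup>2)" for t
    unfolding h_def by (rule vertical_line_bound[OF C bd])
  have [measurable]: "h \<in> borel_measurable borel" using cont by (rule borel_measurable_continuous_onI)
  have hi: "integrable lborel (\<lambda>t. norm (h t))"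
    using integrable_vertical_line[where u = 0, of H c C] cont hb by (simp add: h_def)
  define e where "e = c - m - 1"
  have e: "e < -1" using ac by (simp add: e_def)
  define F where "F = (\<lambda>t y. indicator {1<..} y *\<^sub>R (h t * (of_real (y powr e) * cis (t * ln y))))"
  have pw: "of_real (y powr e) * cis (t * ln y) = complex_of_real y powr (Complex c t - of_real m - 1)"
    if "y > 1" for t y
  proof -
    have "complex_of_real y powr (Complex c t - of_real m - 1) =
        exp (of_real (e * ln y) + \<i> * of_real (t * ln y))"
      using that by (simp add: powr_def Ln_of_real e_def Complex_eq algebra_simps)
    then show ?thesis using that exp_of_real[of "e * ln y", where 'a = complex]
      by (simp add: exp_add cis_conv_exp powr_def)
  qed
  have pi: "set_integrable lborel {1<..} (\<lambda>y. y powr e)" by (rule set_integrable_powr_at_top[OF e])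
  have normF: "norm (F t y) = norm (h t) * (indicator {1<..} y *\<^sub>R (y powr e))" for t y
    by (simp add: F_def norm_mult indicator_def)
  have Fm: "case_prod F \<in> borel_measurable (lborel \<Otimes>\<^sub>M lborel)"
    unfolding F_def by measurable
  have Fy: "integrable lborel (F t)" for t
  proof (rule Bochner_Integration.integrable_bound)
    show "integrable lborel (\<lambda>y. norm (h t) * (indicator {1<..} y *\<^sub>R (y powr e)))"
      using pi unfolding set_integrable_def by (rule integrable_mult_right)
    show "F t \<in> borel_measurable lborel" unfolding F_def by measurable
  qed (auto simp: normF)
  have "integrable (lborel \<Otimes>\<^sub>M lborel) (case_prod F)"
  proof (rule lborel_pair.Fubini_integrable[OF Fm])
    show "integrable lborel (\<lambda>t. \<integral>y. norm (case (t, y) of (t, y) \<Rightarrow> F t y) \<partial>lborel)"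
      using hi by (simp add: normF)
    show "AE t in lborel. integrable lborel (\<lambda>y. case (t, y) of (t, y) \<Rightarrow> F t y)"
      using Fy by simp
  qed
  note Fub = lborel_pair.Fubini_integral[OF this]
  have inner: "(\<integral>y. F t y \<partial>lborel) = h t / (of_real m - Complex c t)" for t
  proof -
    have "(\<integral>y. F t y \<partial>lborel) = (LINT y:{1<..}|lborel. h t * complex_of_real y powr (Complex c t - of_real m - 1))"
      unfolding set_lebesgue_integral_def F_def
      by (intro Bochner_Integration.integral_cong) (auto simp: pw indicator_def)
    also have "\<dots> = h t * (- 1 / (Complex c t - of_real m - 1 + 1))"
      using ac by (subst set_integral_mult_right, subst set_integral_complex_powr_at_top) auto
    also have "- 1 / (Complex c t - of_real m - 1 + 1) = 1 / (of_real m - Complex c t)"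
      by (metis diff_add_cancel minus_diff_eq minus_divide_divide minus_minus)
    finally show ?thesis by simp
  qed
  have "(\<integral>y. \<integral>t. F t y \<partial>lborel \<partial>lborel) = (\<integral>t. h t / (of_real m - Complex c t) \<partial>lborel)"
    unfolding Fub inner ..
  also have "\<dots> = 2 * pi * H (of_real m)"
    unfolding h_def by (rule Cauchy_half_plane(2)[OF hol ac C bd])
  finally have *: "(\<integral>y. \<integral>t. F t y \<partial>lborel \<partial>lborel) = 2 * pi * H (of_real m)" .
  have Ft: "(\<integral>t. F t y \<partial>lborel) = 2 * pi * (indicator {1<..} y *\<^sub>R (mellin_inv c H y * of_real (y powr (- m - 1))))" for y
  proof (cases "y > 1")
    case True
    have "(\<integral>t. F t y \<partial>lborel) = (\<integral>t. of_real (y powr e) * (h t * cis (t * ln y)) \<partial>lborel)"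
      using True by (intro Bochner_Integration.integral_cong) (auto simp: F_def)
    also have "\<dots> = of_real (y powr e) * (\<integral>t. h t * cis (t * ln y) \<partial>lborel)"
      by simp
    also have "y powr e = y powr c * y powr (- m - 1)"
      using powr_add[of y c "- m - 1"] by (simp add: e_def algebra_simps)
    finally show ?thesis using True by (simp add: mellin_inv_def h_def mult_ac)
  qed (simp add: F_def)
  have "(\<integral>y. \<integral>t. F t y \<partial>lborel \<partial>lborel) = 2 * pi * mellin (mellin_inv c H) m"
    unfolding mellin_def set_lebesgue_integral_def Ft by (rule integral_mult_right_zero)
  with * show ?thesis by simp
qed

section \<open>Uniqueness from the transform at large integers\<close>

lemma set_integrable_mellin:
  assumes F: "continuous_on {1..} F" and bd: "\<And>y. y \<ge> 1 \<Longrightarrow> norm (F y) \<le> B * y powr b" and m: "m > b"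
  shows "set_integrable lborel {1<..} (\<lambda>y. F y * complex_of_real (y powr (- m - 1)))"
proof (rule set_integrable_bound)
  show "set_integrable lborel {1<..} (\<lambda>y. B * y powr (b - m - 1))"
    using m by (intro set_integrable_mult_right set_integrable_powr_at_top) auto
  have "(\<lambda>y. indicator {1<..} y *\<^sub>R (F y * of_real (y powr (- m - 1)))) \<in> borel_measurable borel"
    by (intro borel_measurable_continuous_on_indicator continuous_intros continuous_on_subset[OF F]) auto
  then show "set_borel_measurable lborel {1<..} (\<lambda>y. F y * of_real (y powr (- m - 1)))"
    by (simp add: set_borel_measurable_def)
  show "AE y in lborel. y \<in> {1<..} \<longrightarrow> norm (F y * of_real (y powr (- m - 1))) \<le> norm (B * y powr (b - m - 1))"
  proof (intro AE_I2 impI)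
    fix y :: real assume "y \<in> {1<..}"
    then have y: "y > 1" by simp
    have B: "B \<ge> 0" using order_trans[OF norm_ge_zero bd[of 1]] by simp
    have "norm (F y * of_real (y powr (- m - 1))) \<le> (B * y powr b) * y powr (- m - 1)"
      unfolding norm_mult using y B by (intro mult_mono bd) auto
    also have "\<dots> = B * y powr (b - m - 1)"
      using powr_add[of y b "- m - 1"] by (simp add: algebra_simps)
    finally show "norm (F y * of_real (y powr (- m - 1))) \<le> norm (B * y powr (b - m - 1))"
      using B by simp
  qed
qed

text \<open>In the variable t = 1/y the hypothesis says that the weight \<open>w\<close> is
  orthogonal to all polynomials in t. Approximating \<phi>(t) = t^M d(1/t) uniformly on [0,1] shows
  that \<open>w\<close> is orthogonal to \<phi> as well. The product of \<open>w\<close> and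
  \<phi>(1/y) is the square of \<open>d\<close> times a positive power of y, so \<open>d\<close>
  vanishes.\<close>

lemma moments_zero_imp_zero_real:
  fixes d :: "real \<Rightarrow> real" and b B :: real and N :: nat
  assumes cont: "continuous_on {1..} d" and bd: "\<And>y. y \<ge> 1 \<Longrightarrow> \<bar>d y\<bar> \<le> B * y powr b"
    and zero: "\<And>m::nat. m \<ge> N \<Longrightarrow> (LINT y:{1<..}|lborel. d y * y powr (- real m - 1)) = 0"
    and y: "y \<ge> 1"
  shows "d y = 0"
proof -
  obtain M0 :: nat where M0: "b + 1 \<le> real M0" using real_arch_simple by blast
  \<comment> \<open>Being at least \<open>N\<close> keeps all moments used in the range of the
    hypothesis; being at least b + 1 makes \<phi> of order t, hence continuous at 0 with value
    0.\<close>
  define M where "M = max N M0"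
  have M: "M \<ge> N" "b + 1 \<le> real M" using M0 by (auto simp: M_def)
  have B: "B \<ge> 0" using bd[of 1] by simp
  define \<phi> where "\<phi> = (\<lambda>t::real. if t = 0 then 0 else t ^ M * d (1 / t))"
  have \<phi>b: "\<bar>\<phi> t\<bar> \<le> B * t" if "0 \<le> t" "t \<le> 1" for t
  proof (cases "t = 0")
    case False
    with that have t: "t > 0" by simp
    have "\<bar>\<phi> t\<bar> = t ^ M * \<bar>d (1 / t)\<bar>" using t by (simp add: \<phi>_def abs_mult)
    also have "\<dots> \<le> t ^ M * (B * (1 / t) powr b)"
      using t that by (intro mult_left_mono bd) auto
    also have "\<dots> = B * t powr (real M - b)"
      using t by (simp add: powr_divide powr_diff powr_realpow)
    also have "\<dots> \<le> B * t powr 1"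
      using t that M B by (intro mult_left_mono powr_mono') auto
    finally show ?thesis using t by simp
  qed (simp add: \<phi>_def)
  have \<phi>c: "continuous_on {0..1} \<phi>"
    unfolding continuous_on_eq_continuous_within
  proof
    fix t :: real assume t: "t \<in> {0..1}"
    show "continuous (at t within {0..1}) \<phi>"
    proof (cases "t = 0")
      case True
      have "((\<lambda>t. B * t) \<longlongrightarrow> B * 0) (at 0 within {0..1})" by (intro tendsto_intros)
      then have "(\<phi> \<longlongrightarrow> 0) (at 0 within {0..1})"
        using \<phi>b by (intro Lim_null_comparison[of \<phi> "\<lambda>t. B * t"]) (auto simp: eventually_at_filter)
      then show ?thesis using True by (simp add: continuous_within \<phi>_def)
    next
      case False
      have "continuous_on {0<..1} (\<lambda>t. t ^ M * d (1 / t))"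
        by (intro continuous_intros continuous_on_compose2[OF cont]) auto
      then have "continuous_on {0<..1} \<phi>"
        by (rule continuous_on_eq) (auto simp: \<phi>_def)
      then have "continuous (at t within {0<..1}) \<phi>"
        using t False by (auto simp: continuous_on_eq_continuous_within)
      moreover have "at t within {0<..1} = at t within {0..1}"
        using t False by (intro at_within_nhd[of _ "{0<..}"]) auto
      ultimately show ?thesis by simp
    qed
  qed
  \<comment> \<open>With this exponent, \<open>w\<close> times y^(-i) is the integrand of the moment
    of index M + 1 + i, and \<open>w\<close> is dominated by a multiple of y^(-3).\<close>
  define w where "w = (\<lambda>y. d y * y powr (- real M - 2))"
  have wint: "set_integrable lborel {1<..} (\<lambda>y. d y * y powr (- real M - 2) * g y)"
    if g: "continuous_on {1<..} g" "\<And>y. y > 1 \<Longrightarrow> \<bar>g y\<bar> \<le> G" for g G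
  proof (rule set_integrable_bound)
    show "set_integrable lborel {1<..} (\<lambda>y. (B * G) * y powr (-3))"
      by (intro set_integrable_mult_right set_integrable_powr_at_top) auto
    have "(\<lambda>y. indicator {1<..} y *\<^sub>R (d y * y powr (- real M - 2) * g y)) \<in> borel_measurable borel"
      by (intro borel_measurable_continuous_on_indicator continuous_intros continuous_on_subset[OF cont] g) auto
    then show "set_borel_measurable lborel {1<..} (\<lambda>y. d y * y powr (- real M - 2) * g y)"
      by (simp add: set_borel_measurable_def)
    show "AE y in lborel. y \<in> {1<..} \<longrightarrow> norm (d y * y powr (- real M - 2) * g y) \<le> norm (B * G * y powr - 3)"
    proof (intro AE_I2 impI)
      fix y :: real assume "y \<in> {1<..}"
      then have y: "y > 1" by simp
      have G: "0 \<le> G" using g(2)[OF y] by linarith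
      have "norm (d y * y powr (- real M - 2) * g y) = \<bar>d y\<bar> * y powr (- real M - 2) * \<bar>g y\<bar>"
        by (simp add: abs_mult)
      also have "\<dots> \<le> (B * y powr b) * y powr (- real M - 2) * G"
        using y g B by (intro mult_mono bd) auto
      also have "\<dots> = B * G * y powr (b - real M - 2)"
        using powr_add[of y b "- real M - 2"] by (simp add: algebra_simps)
      also have "\<dots> \<le> B * G * y powr (-3)"
        using y M B G by (intro mult_left_mono powr_mono) auto
      finally show "norm (d y * y powr (- real M - 2) * g y) \<le> norm (B * G * y powr - 3)" by simp
    qed
  qed
  have wi: "set_integrable lborel {1<..} w"
    using wint[of "\<lambda>_. 1" 1] by (simp add: w_def)
  have pow: "w y * (1 / y) ^ i = d y * y powr (- real (M + 1 + i) - 1)" if "y > 1" for y i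
    using that by (simp add: w_def powr_diff powr_minus powr_add powr_realpow field_simps)
  have bound_inv: "(1 / y) ^ i \<le> 1" if "y > 1" for y :: real and i
    using that by (intro power_le_one) auto
  define Q where "Q = (LINT y:{1<..}|lborel. w y * \<phi> (1 / y))"
  have \<phi>i: "set_integrable lborel {1<..} (\<lambda>y. w y * \<phi> (1 / y))"
    unfolding w_def
  proof (rule wint)
    show "continuous_on {1<..} (\<lambda>y. \<phi> (1 / y))"
      by (intro continuous_on_compose2[OF \<phi>c] continuous_intros) auto
    show "\<bar>\<phi> (1 / y)\<bar> \<le> B" if "y > 1" for y
      using that B by (intro order_trans[OF \<phi>b]) (auto simp: field_simps mult_le_cancel_left1)
  qed
  have "\<bar>Q\<bar> \<le> \<epsilon> * (LINT y:{1<..}|lborel. \<bar>w y\<bar>)" if \<epsilon>: "\<epsilon> > 0" for \<epsilon>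
  proof -
    obtain g where g: "real_polynomial_function g" "\<And>x. x \<in> {0..1} \<Longrightarrow> \<bar>\<phi> x - g x\<bar> < \<epsilon>"
      using Stone_Weierstrass_real_polynomial_function[OF compact_Icc \<phi>c \<epsilon>] by blast
    obtain a n where an: "g = (\<lambda>x. \<Sum>i\<le>n. a i * x ^ i)"
      using g(1) unfolding real_polynomial_function_iff_sum by blast
    have ii: "set_integrable lborel {1<..} (\<lambda>y. w y * (1 / y) ^ i)" for i
      unfolding w_def by (rule wint[where G = 1]) (auto intro!: continuous_intros bound_inv[simplified])
    have ai: "set_integrable lborel {1<..} (\<lambda>y. a i * (w y * (1 / y) ^ i))" for i
      by (intro set_integrable_mult_right ii)
    then have gi: "set_integrable lborel {1<..} (\<lambda>y. \<Sum>i\<le>n. a i * (w y * (1 / y) ^ i))"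
      unfolding set_integrable_def scaleR_sum_right by (intro Bochner_Integration.integrable_sum)
    have i0: "(LINT y:{1<..}|lborel. w y * (1 / y) ^ i) = 0" for i
    proof -
      have "(LINT y:{1<..}|lborel. w y * (1 / y) ^ i) = (LINT y:{1<..}|lborel. d y * y powr (- real (M + 1 + i) - 1))"
        by (intro set_lebesgue_integral_cong) (auto simp: pow simp del: power_one_over)
      also have "\<dots> = 0" using M by (intro zero) auto
      finally show ?thesis .
    qed
    have "(LINT y:{1<..}|lborel. \<Sum>i\<le>n. a i * (w y * (1 / y) ^ i)) =
       (\<Sum>i\<le>n. LINT y:{1<..}|lborel. a i * (w y * (1 / y) ^ i))"
      using ai unfolding set_integrable_def set_lebesgue_integral_def scaleR_sum_right
      by (intro Bochner_Integration.integral_sum)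
    also have "\<dots> = 0" unfolding set_integral_mult_right i0 by simp
    finally have g0: "(LINT y:{1<..}|lborel. \<Sum>i\<le>n. a i * (w y * (1 / y) ^ i)) = 0" .
    \<comment> \<open>Subtracting the polynomial does not change the integral, since all its moments
      against \<open>w\<close> vanish.\<close>
    have "Q = (LINT y:{1<..}|lborel. w y * \<phi> (1 / y) - (\<Sum>i\<le>n. a i * (w y * (1 / y) ^ i)))"
      using \<phi>i gi by (subst set_integral_diff(2)) (auto simp: Q_def g0)
    also have "\<dots> = (LINT y:{1<..}|lborel. w y * (\<phi> (1 / y) - g (1 / y)))"
      by (simp add: an algebra_simps sum_distrib_left)
    also have "\<bar>\<dots>\<bar> \<le> (LINT y:{1<..}|lborel. \<bar>w y\<bar> * \<epsilon>)"
    proof -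
      have i1: "set_integrable lborel {1<..} (\<lambda>y. w y * (\<phi> (1 / y) - g (1 / y)))"
        using set_integral_diff(1)[OF \<phi>i gi] by (simp add: an algebra_simps sum_distrib_left)
      have i2: "set_integrable lborel {1<..} (\<lambda>y. \<bar>w y\<bar> * \<epsilon>)"
        using wi by (intro set_integrable_mult_left set_integrable_abs)
      have "\<bar>LINT y:{1<..}|lborel. w y * (\<phi> (1 / y) - g (1 / y))\<bar> \<le>
         (LINT y:{1<..}|lborel. \<bar>w y * (\<phi> (1 / y) - g (1 / y))\<bar>)"
        using set_integral_norm_bound[OF i1] by simp
      also have "\<dots> \<le> (LINT y:{1<..}|lborel. \<bar>w y\<bar> * \<epsilon>)"
      proof (rule set_integral_mono)
        show "set_integrable lborel {1<..} (\<lambda>y. \<bar>w y * (\<phi> (1 / y) - g (1 / y))\<bar>)"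
          using i1 by (rule set_integrable_abs)
        show "\<bar>w y * (\<phi> (1 / y) - g (1 / y))\<bar> \<le> \<bar>w y\<bar> * \<epsilon>" if "y \<in> {1<..}" for y
          unfolding abs_mult using that g(2)[of "1 / y"] by (intro mult_left_mono) auto
      qed (rule i2)
      finally show ?thesis .
    qed
    also have "\<dots> = \<epsilon> * (LINT y:{1<..}|lborel. \<bar>w y\<bar>)" by simp
    finally show ?thesis .
  qed
  then have "\<bar>Q\<bar> \<le> 0 + \<epsilon>" if "\<epsilon> > 0" for \<epsilon>
  proof -
    define I where "I = (LINT y:{1<..}|lborel. \<bar>w y\<bar>)"
    have I: "I \<ge> 0" unfolding I_def set_lebesgue_integral_def by (intro integral_nonneg_AE) auto
    \<comment> \<open>Dividing by I + 1 covers the case I = 0 too.\<close>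
    have "\<bar>Q\<bar> \<le> \<epsilon> / (I + 1) * I"
      using \<open>\<And>\<epsilon>. \<epsilon> > 0 \<Longrightarrow> \<bar>Q\<bar> \<le> \<epsilon> * (LINT y:{1<..}|lborel. \<bar>w y\<bar>)\<close>[of "\<epsilon> / (I + 1)"] that I
      by (simp add: I_def)
    also have "\<dots> \<le> \<epsilon>" using that I by (simp add: field_simps)
    finally show ?thesis by simp
  qed
  then have "Q = 0" using field_le_epsilon[of "\<bar>Q\<bar>" 0] by simp
  define q where "q = (\<lambda>y. (d y)\<^sup>2 * y powr (- 2 * real M - 2))"
  have qc: "continuous_on {1..} q"
    unfolding q_def by (intro continuous_intros cont) auto
  have wq: "w y * \<phi> (1 / y) = q y" if "y > 1" for y
    using that by (simp add: w_def \<phi>_def q_def power2_eq_square powr_diff powr_minus powr_realpow field_simps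
        flip: powr_realpow powr_add)
  have q0: "q y \<ge> 0" for y by (simp add: q_def)
  have qi: "set_integrable lborel {1<..} q"
    using \<phi>i by (rule set_integrable_cong[THEN iffD1, rotated -1]) (auto simp: wq)
  have Q: "(LINT y:{1<..}|lborel. q y) = 0"
    using \<open>Q = 0\<close> unfolding Q_def
    by (subst (asm) set_lebesgue_integral_cong[where g = q]) (auto simp: wq)
  \<comment> \<open>The endpoint y + 1 gives a nondegenerate interval whose closure contains
    \<open>y\<close>, also for y = 1.\<close>
  have "(q has_integral 0) {1<..<y + 1}"
  proof -
    have qi': "set_integrable lborel {1<..<y + 1} q" using qi by (rule set_integrable_subset) auto
    have "(LINT y:{1<..<y+1}|lborel. q y) \<le> (LINT y:{1<..}|lborel. q y)"
      unfolding set_lebesgue_integral_def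
      using qi qi' q0 unfolding set_integrable_def
      by (intro integral_mono) (auto simp: indicator_def)
    moreover have "(LINT y:{1<..<y+1}|lborel. q y) \<ge> 0"
      unfolding set_lebesgue_integral_def using q0 by (intro integral_nonneg_AE) auto
    ultimately have "(LINT y:{1<..<y+1}|lborel. q y) = 0" using Q by simp
    then show ?thesis using set_borel_integral_eq_integral[OF qi'] by (metis integrable_integral)
  qed
  then have "(q has_integral 0) (cbox 1 (y + 1))"
    using has_integral_open_interval[of q 0 1 "y + 1"] by simp
  then have "q y = 0"
    using y q0 by (intro has_integral_0_cbox_imp_0[of 1 "y + 1" q y])
      (auto intro: continuous_on_subset[OF qc])
  then show ?thesis using y by (simp add: q_def)
qed

lemma mellin_zero_imp_zero:
  fixes d :: "real \<Rightarrow> complex" and b B :: real and N :: nat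
  assumes cont: "continuous_on {1..} d" and bd: "\<And>y. y \<ge> 1 \<Longrightarrow> norm (d y) \<le> B * y powr b"
    and zero: "\<And>m::nat. m \<ge> N \<Longrightarrow> mellin d (real m) = 0"
    and y: "y \<ge> 1"
  shows "d y = 0"
proof -
  \<comment> \<open>From this index on the transform integral converges absolutely, so real and
    imaginary parts may be taken inside it.\<close>
  obtain N0 :: nat where N0: "b + 1 \<le> real N0" using real_arch_simple by blast
  have int: "set_integrable lborel {1<..} (\<lambda>y. d y * of_real (y powr (- real m - 1)))" if "m \<ge> N0" for m :: nat
    using that N0 by (intro set_integrable_mellin[OF cont bd]) auto
  have "Re (d y) = 0"
  proof (rule moments_zero_imp_zero_real[of "\<lambda>y. Re (d y)" B b "max N N0"])
    fix m assume m: "max N N0 \<le> m"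
    then have "Re (LINT y:{1<..}|lborel. d y * of_real (y powr (- real m - 1))) = 0"
      using zero[of m] by (simp add: mellin_def)
    then show "(LINT y:{1<..}|lborel. Re (d y) * y powr (- real m - 1)) = 0"
      using int[of m] m unfolding set_lebesgue_integral_def set_integrable_def
      by (subst (asm) integral_Re[symmetric]) auto
  qed (use y bd in \<open>auto intro!: continuous_intros cont intro: order_trans[OF abs_Re_le_cmod]\<close>)
  moreover have "Im (d y) = 0"
  proof (rule moments_zero_imp_zero_real[of "\<lambda>y. Im (d y)" B b "max N N0"])
    fix m assume m: "max N N0 \<le> m"
    then have "Im (LINT y:{1<..}|lborel. d y * of_real (y powr (- real m - 1))) = 0"
      using zero[of m] by (simp add: mellin_def)
    then show "(LINT y:{1<..}|lborel. Im (d y) * y powr (- real m - 1)) = 0"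
      using int[of m] m unfolding set_lebesgue_integral_def set_integrable_def
      by (subst (asm) integral_Im[symmetric]) auto
  qed (use y bd in \<open>auto intro!: continuous_intros cont intro: order_trans[OF abs_Im_le_cmod]\<close>)
  ultimately show ?thesis by (simp add: complex_eq_iff)
qed

section \<open>The resolvent kernel\<close>

lemma norm_kernel_k_le: "y \<ge> 0 \<Longrightarrow> norm (kernel_k y) \<le> 1 / 2"
proof -
  assume y: "y \<ge> 0"
  have "4 * y \<le> (1 + y)\<^sup>2" using zero_le_power2[of "1 - y"] by (simp add: power2_eq_square algebra_simps)
  then have "2 * y / (1 + y)\<^sup>2 \<le> 1 / 2" using y by (subst pos_divide_le_eq) auto
  then show ?thesis unfolding kernel_k_def norm_of_real using y by simp
qed

lemma continuous_on_kernel_k: "continuous_on {1..} kernel_k"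
  unfolding kernel_k_def by (intro continuous_intros) auto

text \<open>The substitution y = 1 + (x-1)s moves the variable endpoint into the integrand. What
  remains is an integral over the fixed interval [0,1] that depends continuously on the parameter
  x.\<close>

lemma mconv_continuous:
  assumes F: "continuous_on {1..} F" and G: "continuous_on {1..} G"
  shows "continuous_on {1..} (F \<star> G)"
proof -
  have bnd: "1 \<le> 1 + (x - 1) * s" "1 + (x - 1) * s \<le> x" if "x \<ge> 1" "0 \<le> s" "s \<le> 1" for x s :: real
    using that mult_left_mono[of s 1 "x - 1"] by auto
  define f where "f = (\<lambda>x s. (x - 1) *\<^sub>R (F (x / (1 + (x - 1) * s)) * G (1 + (x - 1) * s) /
      complex_of_real (1 + (x - 1) * s)))"
  have eq: "(F \<star> G) x = integral (cbox 0 1) (f x)" if x: "x \<in> {1..}" for x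
  proof -
    have "((\<lambda>s. (x - 1) *\<^sub>R ((\<lambda>y. F (x / y) * G y / complex_of_real y) (1 + (x - 1) * s))) has_integral
        integral {1 + (x - 1) * 0..1 + (x - 1) * 1} (\<lambda>y. F (x / y) * G y / complex_of_real y)) {0..1}"
    proof (rule has_integral_substitution)
      show "(\<lambda>s. 1 + (x - 1) * s) ` {0..1} \<subseteq> {1..x}" using bnd x by auto
      show "continuous_on {1..x} (\<lambda>y. F (x / y) * G y / complex_of_real y)"
        by (intro continuous_intros continuous_on_compose2[OF F] continuous_on_subset[OF G]) auto
    qed (use x in \<open>auto intro!: derivative_eq_intros\<close>)
    note sub = integral_unique[OF this]
    have "1 + (x - 1) * 0 = 1" "1 + (x - 1) * 1 = x" by simp_all
    from sub[unfolded this] show ?thesis unfolding mconv_def f_def cbox_interval by (rule sym)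
  qed
  have pos: "1 + (x - 1) * s \<noteq> 0" if "x \<ge> 1" "0 \<le> s" "s \<le> 1" for x s :: real
    using bnd(1)[OF that] by linarith
  have posc: "1 + (complex_of_real x - 1) * complex_of_real s \<noteq> 0" if "x \<ge> 1" "0 \<le> s" "s \<le> 1" for x s :: real
  proof -
    have "complex_of_real (1 + (x - 1) * s) \<noteq> 0" using pos[OF that] by (simp only: of_real_eq_0_iff not_False_eq_True)
    then show ?thesis by simp
  qed
  have ge: "1 \<le> x / (1 + (x - 1) * s)" if "x \<ge> 1" "0 \<le> s" "s \<le> 1" for x s :: real
    using bnd[OF that] by (subst le_divide_eq_1_pos) linarith+
  have "continuous_on {1..} (\<lambda>x. integral (cbox 0 1) (f x))"
  proof (rule integral_continuous_on_param)
    show "continuous_on ({1..} \<times> cbox 0 1) (\<lambda>(x, s). f x s)"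
      unfolding f_def case_prod_beta
    proof (intro continuous_intros continuous_on_compose2[OF F] continuous_on_compose2[OF G])
      show "(\<lambda>p::real \<times> real. fst p / (1 + (fst p - 1) * snd p)) ` ({1..} \<times> cbox 0 1) \<subseteq> {1..}"
        using ge by (auto simp: box_real)
    qed (use bnd pos posc in \<open>auto simp: box_real\<close>)
  qed
  then show ?thesis by (rule continuous_on_eq) (use eq in auto)
qed

text \<open>The weight x^2 makes convolution with the kernel a contraction: as k is at most 1/2, the
  factor is at most the integral of y^(-3)/2 over [1,\<infinity>), which is 1/4. Convergence of the
  resolvent series rests on this.\<close>

lemma mconv_kernel_k_bound:
  assumes F: "continuous_on {1..} F" and bd: "\<And>x. x \<ge> 1 \<Longrightarrow> norm (F x) \<le> K * x\<^sup>2" and x: "x \<ge> 1"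
  shows "norm ((F \<star> kernel_k) x) \<le> K / 4 * x\<^sup>2"
proof -
  have K: "K \<ge> 0" using order_trans[OF norm_ge_zero bd[of 1]] by simp
  have "((\<lambda>y. K * x\<^sup>2 / 2 * (1 / y ^ 3)) has_integral (- (K * x\<^sup>2 / 4) / x\<^sup>2 - - (K * x\<^sup>2 / 4) / 1\<^sup>2)) {1..x}"
  proof (rule fundamental_theorem_of_calculus[OF x])
    fix y assume y: "y \<in> {1..x}"
    have "((\<lambda>y. - (K * x\<^sup>2 / 4) / y\<^sup>2) has_real_derivative (K * x\<^sup>2 / 2 * (1 / y ^ 3))) (at y within {1..x})"
      using y by (auto intro!: derivative_eq_intros simp: field_simps power2_eq_square power3_eq_cube)
    then show "((\<lambda>y. - (K * x\<^sup>2 / 4) / y\<^sup>2) has_vector_derivative (K * x\<^sup>2 / 2 * (1 / y ^ 3))) (at y within {1..x})"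
      by (simp add: has_real_derivative_iff_has_vector_derivative)
  qed
  then have int: "((\<lambda>y. K * x\<^sup>2 / 2 * (1 / y ^ 3)) has_integral (K * x\<^sup>2 / 4 - K / 4)) {1..x}"
    using x by simp
  have "norm ((F \<star> kernel_k) x) \<le> integral {1..x} (\<lambda>y. K * x\<^sup>2 / 2 * (1 / y ^ 3))"
    unfolding mconv_def
  proof (rule integral_norm_bound_integral)
    show "(\<lambda>y. F (x / y) * kernel_k y / complex_of_real y) integrable_on {1..x}"
      by (intro integrable_continuous_real continuous_intros continuous_on_compose2[OF F]
          continuous_on_subset[OF continuous_on_kernel_k]) auto
    show "(\<lambda>y. K * x\<^sup>2 / 2 * (1 / y ^ 3)) integrable_on {1..x}" using int by blast
    fix y assume y: "y \<in> {1..x}"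
    have "norm (F (x / y) * kernel_k y / complex_of_real y) = norm (F (x / y)) * norm (kernel_k y) / y"
      using y by (simp add: norm_mult norm_divide)
    also have "\<dots> \<le> (K * (x / y)\<^sup>2) * (1 / 2) / y"
      using y K by (intro divide_right_mono mult_mono bd norm_kernel_k_le) auto
    also have "\<dots> = K * x\<^sup>2 / 2 * (1 / y ^ 3)"
      using y by (simp add: power2_eq_square power3_eq_cube field_simps)
    finally show "norm (F (x / y) * kernel_k y / complex_of_real y) \<le> K * x\<^sup>2 / 2 * (1 / y ^ 3)" .
  qed
  also have "\<dots> = K * x\<^sup>2 / 4 - K / 4" using int by (rule integral_unique)
  finally show ?thesis using K by simp
qed

section \<open>Transforms of convolutions, of the kernel and of R\<close>

text \<open>Fubini and the substitution x = yv, under which the power of x splits into powers of y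
  and v. Extending both functions by 0 to arguments at most 1 encodes the range 1 < y < x in the
  integrand, so the double integral runs over the whole plane.\<close>

lemma mellin_mconv:
  assumes F: "continuous_on {1..} F" and Fb: "\<And>y. y \<ge> 1 \<Longrightarrow> norm (F y) \<le> B * y powr b"
    and G: "continuous_on {1..} G" and Gb: "\<And>y. y \<ge> 1 \<Longrightarrow> norm (G y) \<le> B' * y powr b"
    and m: "m > b"
  shows "mellin (F \<star> G) m = mellin F m * mellin G m"
proof -
  define f where "f = (\<lambda>y. indicator {1<..} y *\<^sub>R F y)"
  define g where "g = (\<lambda>y. indicator {1<..} y *\<^sub>R G y)"
  have [measurable]: "f \<in> borel_measurable borel"
    unfolding f_def by (intro borel_measurable_continuous_on_indicator continuous_on_subset[OF F]) auto
  have [measurable]: "g \<in> borel_measurable borel"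
    unfolding g_def by (intro borel_measurable_continuous_on_indicator continuous_on_subset[OF G]) auto
  define p where "p = (\<lambda>x::real. x powr (- m - 1))"
  have [measurable]: "p \<in> borel_measurable borel" unfolding p_def by measurable
  have mf: "mellin F m = (\<integral>x. f x * p x \<partial>lborel)" and mg: "mellin G m = (\<integral>x. g x * p x \<partial>lborel)"
    unfolding mellin_def set_lebesgue_integral_def f_def g_def p_def by simp_all
  have fi: "integrable lborel (\<lambda>x. f x * p x)" and gi: "integrable lborel (\<lambda>x. g x * p x)"
    using set_integrable_mellin[OF F Fb m] set_integrable_mellin[OF G Gb m]
    unfolding set_integrable_def f_def g_def p_def by simp_all
  define \<Phi> where "\<Phi> = (\<lambda>y x. f (x / y) * (g y / of_real y) * of_real (p x))"
  have \<Phi>m: "case_prod \<Phi> \<in> borel_measurable (lborel \<Otimes>\<^sub>M lborel)"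
    unfolding \<Phi>_def by measurable
  have ps: "p (y * v) = y powr (- m - 1) * p v" if "y > 1" "v > 1" for y v
    using that by (simp add: p_def powr_mult)
  have g0: "g y = 0" if "\<not> y > 1" for y using that by (simp add: g_def)
  have scale: "\<Phi> y (y * v) = (g y / of_real y * of_real (y powr (- m - 1))) * (f v * p v)" if "y > 1" for y v
    using that by (cases "v > 1") (simp_all add: \<Phi>_def ps f_def)
  have \<Phi>x: "integrable lborel (\<Phi> y)" for y
  proof (cases "y > 1")
    case True
    have "integrable lborel (\<lambda>v. \<Phi> y (0 + y * v))"
      using fi True by (simp add: scale)
    then show ?thesis
      using True lborel_integrable_real_affine_iff[of y "\<Phi> y" 0] by simp
  next
    case False
    then show ?thesis by (simp add: \<Phi>_def g0)
  qed
  have inner: "(\<integral>x. \<Phi> y x \<partial>lborel) = g y * p y * mellin F m" for y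
  proof (cases "y > 1")
    case True
    have "(\<integral>x. \<Phi> y x \<partial>lborel) = \<bar>y\<bar> *\<^sub>R (\<integral>v. \<Phi> y (0 + y * v) \<partial>lborel)"
      using True by (intro lborel_integral_real_affine) auto
    also have "\<dots> = y *\<^sub>R ((g y / of_real y * of_real (p y)) * mellin F m)"
      using True by (simp add: scale mf p_def)
    finally show ?thesis using True by (simp add: scaleR_conv_of_real)
  next
    case False
    then show ?thesis by (simp add: \<Phi>_def g0)
  qed
  have inner_norm: "(\<integral>x. norm (\<Phi> y x) \<partial>lborel) = norm (g y * p y) * (\<integral>v. norm (f v * p v) \<partial>lborel)" for y
  proof (cases "y > 1")
    case True
    have "(\<integral>x. norm (\<Phi> y x) \<partial>lborel) = \<bar>y\<bar> *\<^sub>R (\<integral>v. norm (\<Phi> y (0 + y * v)) \<partial>lborel)"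
      using True by (intro lborel_integral_real_affine) auto
    also have "\<dots> = y *\<^sub>R (norm (g y / of_real y * of_real (p y)) * (\<integral>v. norm (f v * p v) \<partial>lborel))"
      using True unfolding add_0 scale[OF True] norm_mult[of "g y / of_real y * of_real (y powr (- m - 1))"] by (simp add: p_def)
    finally show ?thesis using True by (simp add: norm_mult norm_divide)
  next
    case False
    then show ?thesis by (simp add: \<Phi>_def g0)
  qed
  have "integrable (lborel \<Otimes>\<^sub>M lborel) (case_prod \<Phi>)"
  proof (rule lborel_pair.Fubini_integrable[OF \<Phi>m])
    show "integrable lborel (\<lambda>y. \<integral>x. norm (case (y, x) of (y, x) \<Rightarrow> \<Phi> y x) \<partial>lborel)"
      using gi by (simp only: prod.case inner_norm) (intro integrable_mult_left integrable_norm)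
    show "AE y in lborel. integrable lborel (\<lambda>x. case (y, x) of (y, x) \<Rightarrow> \<Phi> y x)"
      using \<Phi>x by simp
  qed
  note Fub = lborel_pair.Fubini_integral[OF this]
  have "(\<integral>y. \<Phi> y x \<partial>lborel) = indicator {1<..} x *\<^sub>R ((F \<star> G) x * of_real (p x))" for x
  proof (cases "x > 1")
    case True
    have int: "set_integrable lborel {1..x} (\<lambda>y. F (x / y) * G y / complex_of_real y)"
      by (intro borel_integrable_atLeastAtMost' continuous_intros continuous_on_compose2[OF F]
          continuous_on_subset[OF G]) auto
    then have int': "set_integrable lborel {1<..<x} (\<lambda>y. F (x / y) * G y / complex_of_real y)"
      by (rule set_integrable_subset) auto
    have ind: "f (x / y) * (g y / of_real y) = indicator {1<..<x} y *\<^sub>R (F (x / y) * G y / complex_of_real y)" for y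
    proof (cases "y > 1")
      case y: True
      then have "x / y > 1 \<longleftrightarrow> y < x" by (simp add: less_divide_eq)
      then show ?thesis using y by (simp add: f_def g_def indicator_def)
    qed (simp add: g0)
    have "(\<integral>y. \<Phi> y x \<partial>lborel) = (\<integral>y. f (x / y) * (g y / of_real y) \<partial>lborel) * of_real (p x)"
      unfolding \<Phi>_def by (rule integral_mult_left_zero)
    also have "(\<integral>y. f (x / y) * (g y / of_real y) \<partial>lborel) =
        (LINT y:{1<..<x}|lborel. F (x / y) * G y / complex_of_real y)"
      unfolding set_lebesgue_integral_def ind ..
    also have "\<dots> = integral {1<..<x} (\<lambda>y. F (x / y) * G y / complex_of_real y)"
      using int' by (rule set_borel_integral_eq_integral)
    also have "\<dots> = (F \<star> G) x" unfolding mconv_def using integral_open_interval[of 1 x] by (simp only: box_real)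
    finally show ?thesis using True by simp
  next
    case False
    have "f (x / y) = 0" if "y > 1" for y
      using that False by (simp add: f_def less_divide_eq)
    then have "\<Phi> y x = 0" for y using g0[of y] by (cases "y > 1") (auto simp: \<Phi>_def)
    then show ?thesis using False by simp
  qed
  then have "mellin (F \<star> G) m = (\<integral>x. \<integral>y. \<Phi> y x \<partial>lborel \<partial>lborel)"
    unfolding mellin_def set_lebesgue_integral_def p_def by simp
  also have "\<dots> = (\<integral>y. g y * p y * mellin F m \<partial>lborel)" unfolding Fub inner ..
  also have "\<dots> = mellin F m * mellin G m" by (simp add: mg)
  finally show ?thesis .
qed

lemma mellin_kernel_k_bound:
  assumes m: "m > 0"
  shows "norm (mellin kernel_k m) \<le> 1 / (2 * m)"
proof -
  have i: "set_integrable lborel {1<..} (\<lambda>y. kernel_k y * complex_of_real (y powr (- m - 1)))"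
    using norm_kernel_k_le m
    by (intro set_integrable_mellin[OF continuous_on_kernel_k, of "1 / 2" 0]) auto
  have j: "set_integrable lborel {1<..} (\<lambda>y. 1 / 2 * y powr (- m - 1))"
    using m by (intro set_integrable_mult_right set_integrable_powr_at_top) auto
  have "norm (mellin kernel_k m) \<le> (LINT y:{1<..}|lborel. norm (kernel_k y * complex_of_real (y powr (- m - 1))))"
    unfolding mellin_def by (rule set_integral_norm_bound[OF i])
  also have "\<dots> \<le> (LINT y:{1<..}|lborel. 1 / 2 * y powr (- m - 1))"
  proof (rule set_integral_mono[OF _ j])
    show "set_integrable lborel {1<..} (\<lambda>y. norm (kernel_k y * complex_of_real (y powr (- m - 1))))"
      using i by (rule set_integrable_norm)
    show "norm (kernel_k y * complex_of_real (y powr (- m - 1))) \<le> 1 / 2 * y powr (- m - 1)" if "y \<in> {1<..}" for y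
      unfolding norm_mult using that norm_kernel_k_le[of y] by (intro mult_mono) auto
  qed
  also have "\<dots> = 1 / (2 * m)"
  proof -
    have "complex_of_real (LINT y:{1<..}|lborel. y powr (- m - 1)) =
        (LINT y:{1<..}|lborel. complex_of_real (y powr (- m - 1)))"
      by (rule set_integral_complex_of_real[symmetric])
    also have "\<dots> = (LINT y:{1<..}|lborel. complex_of_real y powr (of_real (- m - 1)))"
      by (intro set_lebesgue_integral_cong) (auto simp: powr_of_real simp del: of_real_diff of_real_minus)
    also have "\<dots> = of_real (1 / m)"
      using m by (subst set_integral_complex_powr_at_top) auto
    finally have "(LINT y:{1<..}|lborel. y powr (- m - 1)) = 1 / m" by (simp only: of_real_eq_iff)
    then show ?thesis by simp
  qed
  finally show ?thesis .
qed

text \<open>The combined integrand has the primitive -2 y^(-m)/(1+y), which is -1 at y = 1 and tends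
  to 0 at infinity. For one plus the transform this recurrence is
  \<open>gstar_shift\<close>.\<close>

lemma mellin_kernel_k_recurrence:
  assumes m: "m > 0"
  shows "of_real (m + 1) * mellin kernel_k m + of_real m * mellin kernel_k (m + 1) = 1"
proof -
  have i: "set_integrable lborel {1<..} (\<lambda>y. kernel_k y * complex_of_real (y powr (- m - 1)))" if "m > 0" for m
    using norm_kernel_k_le that
    by (intro set_integrable_mellin[OF continuous_on_kernel_k, of "1 / 2" 0]) auto
  define f where "f = (\<lambda>y. of_real (m + 1) * (kernel_k y * complex_of_real (y powr (- m - 1))) +
      of_real m * (kernel_k y * complex_of_real (y powr (- (m + 1) - 1))))"
  have ii: "set_integrable lborel {1<..} f"
    unfolding f_def using m by (intro set_integral_add set_integrable_mult_right i) auto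
  have ei: "einterval (ereal 1) \<infinity> = {1<..}" by (auto simp: einterval_def)
  define P where "P = (\<lambda>y. complex_of_real (- 2 * y powr (- m) / (1 + y)))"
  have "(LBINT y=ereal 1..\<infinity>. f y) = 0 - (- 1)"
  proof (rule interval_integral_FTC_integrable)
    show "set_integrable lborel (einterval (ereal 1) \<infinity>) f" using ii by (simp add: ei)
    show "(P has_vector_derivative f y) (at y)" if "ereal 1 < ereal y" for y
    proof -
      have y: "y > 1" using that by simp
      have fy: "f y = of_real ((m + 1) * (2 * y / (1 + y)\<^sup>2 * y powr (- m - 1)) +
           m * (2 * y / (1 + y)\<^sup>2 * y powr (- (m + 1) - 1)))"
        unfolding f_def kernel_k_def by (simp only: of_real_mult of_real_add)
      have e: "y powr (- m - 1) = y powr (- m) / y" "y powr (- (m + 1) - 1) = y powr (- m) / y ^ 2"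
      proof -
        show "y powr (- m - 1) = y powr (- m) / y" using y by (simp add: powr_diff)
        have "y powr (- (m + 1) - 1) = y powr (- m - 2)" by (rule arg_cong) simp
        also have "\<dots> = y powr (- m) / y ^ 2" using y by (simp add: powr_diff)
        finally show "y powr (- (m + 1) - 1) = y powr (- m) / y ^ 2" .
      qed
      have "((\<lambda>y. - 2 * y powr (- m) / (1 + y)) has_real_derivative
         (m + 1) * (2 * y / (1 + y)\<^sup>2 * y powr (- m - 1)) +
           m * (2 * y / (1 + y)\<^sup>2 * y powr (- (m + 1) - 1))) (at y)"
      proof -
        have "((\<lambda>y. - 2 * y powr (- m) / (1 + y)) has_real_derivative
           ((- 2 * (- m * (y powr (- m) / y))) * (1 + y) - (- 2 * y powr (- m)) * 1) / ((1 + y) * (1 + y))) (at y)"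
        proof (rule DERIV_divide)
          show "((\<lambda>y. - 2 * y powr (- m)) has_real_derivative - 2 * (- m * (y powr (- m) / y))) (at y)"
            using y by (auto intro!: derivative_eq_intros simp: e(1))
          show "((\<lambda>y. 1 + y) has_real_derivative 1) (at y)" by (auto intro!: derivative_eq_intros)
        qed (use y in auto)
        also have "((- 2 * (- m * (y powr (- m) / y))) * (1 + y) - (- 2 * y powr (- m)) * 1) / ((1 + y) * (1 + y)) =
            (m + 1) * (2 * y / (1 + y)\<^sup>2 * (y powr (- m) / y)) + m * (2 * y / (1 + y)\<^sup>2 * (y powr (- m) / y ^ 2))"
        proof -
          define Y where "Y = y powr (- m)"
          define w where "w = 1 + y"
          have w: "w \<noteq> 0" "y \<noteq> 0" using y by (auto simp: w_def)
          have "((- 2 * (- m * (Y / y))) * w - (- 2 * Y) * 1) / (w * w) =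
              (m + 1) * (2 * y / w\<^sup>2 * (Y / y)) + m * (2 * y / w\<^sup>2 * (Y / y ^ 2))"
            using w by (simp add: field_simps power2_eq_square) (simp add: w_def algebra_simps)
          then show ?thesis by (simp only: Y_def w_def)
        qed
        finally show ?thesis unfolding e .
      qed
      then have "((\<lambda>y. - 2 * y powr (- m) / (1 + y)) has_vector_derivative
         (m + 1) * (2 * y / (1 + y)\<^sup>2 * y powr (- m - 1)) +
           m * (2 * y / (1 + y)\<^sup>2 * y powr (- (m + 1) - 1))) (at y)"
        by (simp only: has_real_derivative_iff_has_vector_derivative)
      then show ?thesis unfolding P_def fy by (rule bounded_linear.has_vector_derivative[OF bounded_linear_of_real])
    qed
    show "isCont f y" if "ereal 1 < ereal y" for y
    proof -
      have "isCont kernel_k y"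
        using that by (intro continuous_on_interior[OF continuous_on_kernel_k]) simp
      then show ?thesis using that unfolding f_def by (auto intro!: continuous_intros)
    qed
    have "isCont P 1" unfolding P_def by (intro continuous_intros) auto
    then have "(P \<longlongrightarrow> P 1) (at_right 1)"
      by (auto simp: isCont_def intro: tendsto_within_subset)
    then show "((P \<circ> real_of_ereal) \<longlongrightarrow> - 1) (at_right (ereal 1))"
      by (simp add: ereal_tendsto_simps P_def)
    have "((\<lambda>y. - 2 * y powr (- m) * inverse (1 + y)) \<longlongrightarrow> - 2 * 0 * 0) at_top"
      using m by (intro tendsto_intros tendsto_neg_powr filterlim_ident tendsto_inverse_0_at_top
          filterlim_tendsto_add_at_top[OF tendsto_const]) auto
    then have "(P \<longlongrightarrow> of_real 0) at_top"
      unfolding P_def divide_inverse by (intro tendsto_of_real) simp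
    then show "((P \<circ> real_of_ereal) \<longlongrightarrow> 0) (at_left \<infinity>)"
      by (simp add: ereal_tendsto_simps)
  qed auto
  then have "(LINT y:{1<..}|lborel. f y) = 1"
    by (simp add: interval_lebesgue_integral_def ei)
  moreover have "(LINT y:{1<..}|lborel. f y) = of_real (m + 1) * mellin kernel_k m + of_real m * mellin kernel_k (m + 1)"
    unfolding f_def mellin_def set_integral_mult_right[symmetric] using m
    by (intro set_integral_add(2) set_integrable_mult_right i) auto
  ultimately show ?thesis by simp
qed

text \<open>By the common recurrence, the discrepancy at m is m/(m+1) times the one at m + 1 in
  absolute value, hence \<open>D\<close> does not decrease. Both transforms are asymptotically
  trivial, so \<open>D\<close> also tends to 0 and must vanish from the start.\<close>

lemma gstar_eq_mellin_kernel_k: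
  assumes "m \<ge> 1"
  shows "gstar (- of_nat m) = 1 + mellin kernel_k (real m)"
proof -
  define D where "D = (\<lambda>m. norm (gstar (- of_nat m) - 1 - mellin kernel_k (real m)))"
  have step: "D m \<le> D (Suc m)" if m: "m \<ge> 1" for m
  proof -
    define c where "c = mellin kernel_k (real m)"
    define c' where "c' = mellin kernel_k (real m + 1)"
    define g where "g = gstar (- of_nat (Suc m))"
    have m1: "of_nat m + 1 \<noteq> (0::complex)" by (metis of_nat_Suc of_nat_eq_0_iff nat.distinct(1) add.commute)
    have rec: "(of_nat m + 1) * c + of_nat m * c' = 1"
      using mellin_kernel_k_recurrence[of "real m"] m by (simp add: c_def c'_def)
    have "of_nat m \<noteq> (-1 :: complex)" using m1 by (metis add_eq_0_iff2 minus_minus)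
    from gstar_shift[OF this] have gs: "gstar (- of_nat m) = 2 - of_nat m / (of_nat m + 1) * g"
      by (simp add: g_def add_ac)
    have cr: "c = (1 - of_nat m * c') / (of_nat m + 1)"
      using rec m1 by (simp add: field_simps)
    have "2 - of_nat m / (of_nat m + 1) * g - 1 - (1 - of_nat m * c') / (of_nat m + 1) =
        - (of_nat m / (of_nat m + 1)) * (g - 1 - c')"
    proof -
      define q where "q = of_nat m / (of_nat m + 1 :: complex)"
      have "1 / (of_nat m + 1) = 1 - q" using m1 by (simp add: q_def field_simps)
      then have "(1 - of_nat m * c') / (of_nat m + 1) = (1 - q) - q * c'"
        by (simp add: diff_divide_distrib q_def)
      then show ?thesis unfolding q_def[symmetric] by (simp add: algebra_simps)
    qed
    then have "gstar (- of_nat m) - 1 - c = - (of_nat m / (of_nat m + 1)) * (g - 1 - c')"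
      unfolding gs cr .
    then have "norm (gstar (- of_nat m) - 1 - c) = norm (of_nat m / (of_nat m + 1) :: complex) * norm (g - 1 - c')"
      by (simp only: norm_mult norm_minus_cancel)
    also have "norm (of_nat m / (of_nat m + 1) :: complex) = real m / (real m + 1)"
      by (metis norm_divide norm_of_nat of_nat_Suc add.commute)
    also have "\<dots> * norm (g - 1 - c') \<le> 1 * norm (g - 1 - c')"
      by (intro mult_right_mono) auto
    finally show ?thesis by (simp add: D_def c_def c'_def g_def add.commute)
  qed
  have mono: "D m \<le> D (m + n)" for n
  proof (induction n)
    case (Suc n)
    then show ?case using step[of "m + n"] assms by simp
  qed simp
  obtain C where C: "C \<ge> 0" "\<And>s. Re s \<ge> 1 \<Longrightarrow> norm (gstar (-s) - 1 - 1 / (2 * s)) \<le> C / norm s ^ 2"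
    using gstar_asymp_right by blast
  have Dn: "D n \<le> C * inverse (real n) ^ 2 + inverse (real n)" if n: "n \<ge> 1" for n
  proof -
    have "gstar (- of_nat n) - 1 - mellin kernel_k (real n) =
       (gstar (- of_nat n) - 1 - 1 / (2 * of_nat n)) + (1 / (2 * of_nat n) - mellin kernel_k (real n))"
      by simp
    then have "D n \<le> norm (gstar (- of_nat n) - 1 - 1 / (2 * of_nat n)) + norm (1 / (2 * of_nat n) - mellin kernel_k (real n))"
      unfolding D_def by (metis norm_triangle_ineq)
    also have "\<dots> \<le> C / real n ^ 2 + (1 / (2 * real n) + 1 / (2 * real n))"
    proof (intro add_mono)
      show "norm (gstar (- of_nat n) - 1 - 1 / (2 * of_nat n)) \<le> C / real n ^ 2"
        using C(2)[of "of_nat n"] n by simp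
      have "norm (1 / (2 * of_nat n) - mellin kernel_k (real n)) \<le>
          norm (1 / (2 * of_nat n) :: complex) + norm (mellin kernel_k (real n))"
        by (rule norm_triangle_ineq4)
      also have "\<dots> \<le> 1 / (2 * real n) + 1 / (2 * real n)"
        using mellin_kernel_k_bound[of "real n"] n by (simp add: norm_divide norm_mult)
      finally show "norm (1 / (2 * of_nat n) - mellin kernel_k (real n)) \<le> 1 / (2 * real n) + 1 / (2 * real n)" .
    qed
    finally show ?thesis by (simp add: field_simps)
  qed
  have "(\<lambda>n. C * inverse (real n) ^ 2 + inverse (real n)) \<longlonglongrightarrow> C * 0 ^ 2 + 0"
    by (intro tendsto_intros lim_inverse_n)
  then have "(\<lambda>n. C * inverse (real n) ^ 2 + inverse (real n)) \<longlonglongrightarrow> 0" by simp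
  moreover have "\<exists>N. \<forall>n\<ge>N. D m \<le> C * inverse (real n) ^ 2 + inverse (real n)"
  proof (intro exI allI impI)
    fix n assume n: "n \<ge> m"
    have "D m \<le> D n" using mono[of "n - m"] n by simp
    also have "\<dots> \<le> C * inverse (real n) ^ 2 + inverse (real n)" using n assms by (intro Dn) auto
    finally show "D m \<le> C * inverse (real n) ^ 2 + inverse (real n)" .
  qed
  ultimately have "D m \<le> 0" by (rule LIMSEQ_le_const)
  then show ?thesis by (simp add: D_def algebra_simps)
qed

text \<open>One induction serves all three claims, since multiplicativity of the transform needs
  continuity and the bound for the preceding power. The restriction m > 2 comes from the growth x^2
  in that bound.\<close>

lemma mconv_pow_kernel_k:
  shows "continuous_on {1..} (mconv_pow kernel_k (Suc n))"
    and "\<And>x. x \<ge> 1 \<Longrightarrow> norm (mconv_pow kernel_k (Suc n) x) \<le> 1 / 2 * (1 / 4) ^ n * x\<^sup>2"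
    and "\<And>m. m > 2 \<Longrightarrow> mellin (mconv_pow kernel_k (Suc n)) m = mellin kernel_k m ^ Suc n"
proof (induction n)
  case 0
  {
    case 1
    show ?case using continuous_on_kernel_k by (simp add: mconv_pow_def)
  next
    case (2 x)
    have "1 \<le> x\<^sup>2" using 2 by simp
    then have "norm (kernel_k x) \<le> 1 / 2 * x\<^sup>2" using norm_kernel_k_le[of x] 2 by linarith
    then show ?case by (simp add: mconv_pow_def)
  next
    case (3 m)
    show ?case by (simp add: mconv_pow_def)
  }
next
  case (Suc n)
  have S: "mconv_pow kernel_k (Suc (Suc n)) = mconv_pow kernel_k (Suc n) \<star> kernel_k"
    using mconv_pow_Suc[of "Suc n" kernel_k] by simp
  {
    case 1
    show ?case unfolding S by (intro mconv_continuous Suc continuous_on_kernel_k)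
  next
    case (2 x)
    from mconv_kernel_k_bound[OF Suc(1,2) this] show ?case unfolding S by simp
  next
    case (3 m)
    have "mellin (mconv_pow kernel_k (Suc n) \<star> kernel_k) m = mellin (mconv_pow kernel_k (Suc n)) m * mellin kernel_k m"
    proof (rule mellin_mconv[where b = 2])
      show "norm (mconv_pow kernel_k (Suc n) y) \<le> 1 / 2 * (1 / 4) ^ n * y powr 2" if "y \<ge> 1" for y
        using Suc(2)[of y] that by simp
      show "norm (kernel_k y) \<le> 1 / 2 * y powr 2" if "y \<ge> 1" for y
      proof -
        have "1 \<le> y\<^sup>2" using that by simp
        moreover have "y powr 2 = y\<^sup>2" using that by simp
        ultimately show ?thesis using norm_kernel_k_le[of y] that by linarith
      qed
    qed (use 3 Suc continuous_on_kernel_k in auto)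
    then show ?case unfolding S Suc(3)[OF 3] by (simp add: mult.commute)
  }
qed

lemma resolvent_R_series:
  assumes "x \<ge> 1"
  shows "norm ((-1) ^ (Suc n + 1) * mconv_pow kernel_k (Suc n) x) \<le> 1 / 2 * x\<^sup>2 * (1 / 4) ^ n"
proof -
  have "norm ((-1) ^ (Suc n + 1) * mconv_pow kernel_k (Suc n) x) = norm (mconv_pow kernel_k (Suc n) x)"
    by (simp only: norm_mult norm_power norm_minus_cancel norm_one power_one mult_1_left)
  also have "\<dots> \<le> 1 / 2 * (1 / 4) ^ n * x\<^sup>2" by (rule mconv_pow_kernel_k(2)[OF assms])
  also have "\<dots> = 1 / 2 * x\<^sup>2 * (1 / 4) ^ n" by (simp only: mult_ac)
  finally show ?thesis .
qed

lemma resolvent_R_continuous: "continuous_on {1..} resolvent_R"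
proof -
  have *: "continuous_on {1..b} resolvent_R" for b
  proof (rule uniform_limit_theorem)
    show "uniform_limit {1..b} (\<lambda>N x. \<Sum>n<N. (-1) ^ (Suc n + 1) * mconv_pow kernel_k (Suc n) x) resolvent_R sequentially"
      unfolding resolvent_R_def[abs_def]
    proof (rule Weierstrass_m_test)
      show "norm ((-1) ^ (Suc n + 1) * mconv_pow kernel_k (Suc n) x) \<le> 1 / 2 * b\<^sup>2 * (1 / 4) ^ n"
        if "x \<in> {1..b}" for n x
      proof -
        have "norm ((-1) ^ (Suc n + 1) * mconv_pow kernel_k (Suc n) x) \<le> 1 / 2 * x\<^sup>2 * (1 / 4) ^ n"
          using that by (intro resolvent_R_series) auto
        also have "\<dots> \<le> 1 / 2 * b\<^sup>2 * (1 / 4) ^ n"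
          using that by (intro mult_right_mono mult_left_mono power_mono) auto
        finally show ?thesis .
      qed
      show "summable (\<lambda>n. 1 / 2 * b\<^sup>2 * (1 / 4) ^ n)" by (intro summable_mult summable_geometric) auto
    qed
    show "\<forall>\<^sub>F N in sequentially. continuous_on {1..b} (\<lambda>x. \<Sum>n<N. (-1) ^ (Suc n + 1) * mconv_pow kernel_k (Suc n) x)"
      by (intro always_eventually allI continuous_intros continuous_on_subset[OF mconv_pow_kernel_k(1)]) auto
  qed auto
  show ?thesis
    unfolding continuous_on_eq_continuous_within
  proof
    fix x :: real assume x: "x \<in> {1..}"
    have "continuous (at x within {1..x+1}) resolvent_R"
      using *[of "x + 1"] x by (auto simp: continuous_on_eq_continuous_within)
    moreover have "at x within {1..x+1} = at x within {1..}"
      by (rule at_within_nhd[of _ "{..<x+1}"]) auto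
    ultimately show "continuous (at x within {1..}) resolvent_R" by simp
  qed
qed

lemma resolvent_R_bound:
  assumes "x \<ge> 1"
  shows "norm (resolvent_R x) \<le> x\<^sup>2"
proof -
  have s: "summable (\<lambda>n. 1 / 2 * x\<^sup>2 * (1 / 4 :: real) ^ n)" by (intro summable_mult summable_geometric) auto
  have "norm (resolvent_R x) \<le> (\<Sum>n. 1 / 2 * x\<^sup>2 * (1 / 4) ^ n)"
    unfolding resolvent_R_def by (rule norm_suminf_le[OF resolvent_R_series[OF assms] s])
  also have "\<dots> = 1 / 2 * x\<^sup>2 * (\<Sum>n. (1 / 4) ^ n)" by (intro suminf_mult summable_geometric) auto
  also have "(\<Sum>n. (1 / 4 :: real) ^ n) = 4 / 3" by (subst suminf_geometric) auto
  finally show ?thesis using zero_le_power2[of x] by linarith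
qed

text \<open>Termwise integration, dominated by a geometric series times y^(1-m), which is integrable
  for m > 2. With c the transform of the kernel, the terms become c (-c)^n, and |c| <= 1/(2m) < 1
  allows summation.\<close>

lemma mellin_resolvent_R:
  assumes m: "m > 2"
  shows "mellin resolvent_R m = mellin kernel_k m / (1 + mellin kernel_k m)"
proof -
  define c where "c = mellin kernel_k m"
  define f where "f = (\<lambda>n y. indicator {1<..} y *\<^sub>R ((-1) ^ (Suc n + 1) * mconv_pow kernel_k (Suc n) y * of_real (y powr (- m - 1))))"
  have fi: "integrable lborel (f n)" for n
  proof -
    have "set_integrable lborel {1<..} (\<lambda>y. (-1) ^ (Suc n + 1) * mconv_pow kernel_k (Suc n) y * complex_of_real (y powr (- m - 1)))"
    proof (rule set_integrable_mellin[where b = 2, OF _ _ m])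
      show "norm ((-1) ^ (Suc n + 1) * mconv_pow kernel_k (Suc n) y) \<le> 1 / 2 * (1 / 4) ^ n * y powr 2" if "y \<ge> 1" for y
        using resolvent_R_series[OF that, of n] that by (simp add: mult_ac)
    qed (intro continuous_intros mconv_pow_kernel_k)
    then show ?thesis by (simp add: set_integrable_def f_def)
  qed
  have pi: "integrable lborel (\<lambda>y. indicator {1<..} y *\<^sub>R y powr (1 - m))"
    using set_integrable_powr_at_top[of "1 - m"] m by (simp add: set_integrable_def)
  have fb: "norm (f n y) \<le> 1 / 2 * (1 / 4) ^ n * (indicator {1<..} y *\<^sub>R y powr (1 - m))" for n y
  proof (cases "y > 1")
    case True
    have "norm (f n y) = norm ((-1) ^ (Suc n + 1) * mconv_pow kernel_k (Suc n) y) * y powr (- m - 1)"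
      using True by (simp add: f_def norm_mult)
    also have "\<dots> \<le> (1 / 2 * y\<^sup>2 * (1 / 4) ^ n) * y powr (- m - 1)"
      using True by (intro mult_right_mono resolvent_R_series) auto
    also have "\<dots> = 1 / 2 * (1 / 4) ^ n * (y powr 2 * y powr (- m - 1))" using True by simp
    also have "y powr 2 * y powr (- m - 1) = y powr (1 - m)" by (simp flip: powr_add)
    finally show ?thesis using True by simp
  qed (simp add: f_def)
  have "(\<lambda>n. integral\<^sup>L lborel (f n)) sums (\<integral>y. (\<Sum>n. f n y) \<partial>lborel)"
  proof (rule sums_integral[OF fi])
    show "AE y in lborel. summable (\<lambda>n. norm (f n y))"
    proof (rule AE_I2, rule summable_comparison_test'[where N = 0])
      fix y :: real
      show "summable (\<lambda>n. 1 / 2 * (1 / 4) ^ n * (indicator {1<..} y *\<^sub>R y powr (1 - m)))"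
        by (rule summable_mult2[OF summable_mult[OF summable_geometric]]) simp
    qed (use fb in auto)
    show "summable (\<lambda>n. \<integral>y. norm (f n y) \<partial>lborel)"
    proof (rule summable_comparison_test'[where N = 0])
      show "summable (\<lambda>n. 1 / 2 * (1 / 4) ^ n * (\<integral>y. indicator {1<..} y *\<^sub>R y powr (1 - m) \<partial>lborel))"
        by (rule summable_mult2[OF summable_mult[OF summable_geometric]]) simp
      fix n
      have "(\<integral>y. norm (f n y) \<partial>lborel) \<le> (\<integral>y. 1 / 2 * (1 / 4) ^ n * (indicator {1<..} y *\<^sub>R y powr (1 - m)) \<partial>lborel)"
        using fi pi fb by (intro integral_mono integrable_norm integrable_mult_right) auto
      also have "\<dots> = 1 / 2 * (1 / 4) ^ n * (\<integral>y. indicator {1<..} y *\<^sub>R y powr (1 - m) \<partial>lborel)"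
        by (rule integral_mult_right_zero)
      finally show "norm (\<integral>y. norm (f n y) \<partial>lborel) \<le> 1 / 2 * (1 / 4) ^ n * (\<integral>y. indicator {1<..} y *\<^sub>R y powr (1 - m) \<partial>lborel)"
        by simp
    qed
  qed
  moreover have "integral\<^sup>L lborel (f n) = c * (- c) ^ n" for n
  proof -
    have "integral\<^sup>L lborel (f n) = (-1) ^ (Suc n + 1) * mellin (mconv_pow kernel_k (Suc n)) m"
      unfolding f_def mellin_def set_lebesgue_integral_def
      by (subst integral_mult_right_zero[symmetric]) (intro Bochner_Integration.integral_cong, auto)
    also have "\<dots> = c * (- c) ^ n"
      unfolding mconv_pow_kernel_k(3)[OF m] c_def[symmetric] by (simp add: power_minus[of c])
    finally show ?thesis .
  qed
  moreover have "(\<Sum>n. f n y) = indicator {1<..} y *\<^sub>R (resolvent_R y * of_real (y powr (- m - 1)))" for y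
  proof (cases "y > 1")
    case True
    have "summable (\<lambda>n. (-1) ^ (Suc n + 1) * mconv_pow kernel_k (Suc n) y)"
    proof (rule summable_comparison_test'[where N = 0])
      show "summable (\<lambda>n. 1 / 2 * y\<^sup>2 * (1 / 4 :: real) ^ n)" by (intro summable_mult summable_geometric) auto
      show "norm ((-1) ^ (Suc n + 1) * mconv_pow kernel_k (Suc n) y) \<le> 1 / 2 * y\<^sup>2 * (1 / 4) ^ n" for n
        using True by (intro resolvent_R_series) auto
    qed
    from suminf_mult2[OF this, of "of_real (y powr (- m - 1))"] show ?thesis
      using True unfolding f_def resolvent_R_def by simp
  qed (simp add: f_def)
  ultimately have "(\<lambda>n. c * (- c) ^ n) sums mellin resolvent_R m"
    by (simp add: mellin_def set_lebesgue_integral_def)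
  moreover have "(\<lambda>n. c * (- c) ^ n) sums (c * (1 / (1 - - c)))"
  proof (intro sums_mult geometric_sums)
    have "norm c \<le> 1 / (2 * m)" unfolding c_def using m by (intro mellin_kernel_k_bound) auto
    also have "\<dots> < 1" using m by simp
    finally show "norm (- c) < 1" by simp
  qed
  ultimately have "mellin resolvent_R m = c * (1 / (1 - - c))" by (rule sums_unique2)
  then show ?thesis by (simp add: c_def)
qed

text \<open>At a pole the value of \<open>gstar\<close> is an artefact of the totalised
  \<open>Digamma\<close>; the hypothesis therefore excludes poles and asks for nonvanishing
  elsewhere in the half-plane.\<close>

theorem theorem2p5:
  fixes \<alpha>\<^sub>1 :: real
  assumes "\<And>z. Re z < \<alpha>\<^sub>1 \<Longrightarrow> \<not> is_pole gstar z \<Longrightarrow> gstar z \<noteq> 0"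
  shows "\<forall>\<epsilon>>0. resolvent_R \<in> O[at_top](\<lambda>y. complex_of_real (y powr (- \<alpha>\<^sub>1 + \<epsilon>)))"
proof (intro allI impI)
  fix \<epsilon> :: real assume \<epsilon>: "\<epsilon> > 0"
  define c where "c = - \<alpha>\<^sub>1 + \<epsilon>"
  \<comment> \<open>Any A with -A < c would do: the pole of the subtracted term then lies to the
    left of the line, and y^(-A) is at most y^c.\<close>
  define A where "A = \<bar>c\<bar> + 1"
  define H where "H = (\<lambda>s. 1 - inv_gstar s - 1 / (2 * (s + of_real A)))"
  have holJ: "inv_gstar holomorphic_on {s. Re s > - \<alpha>\<^sub>1}"
    using assms by (rule inv_gstar_holomorphic)
  have c: "- \<alpha>\<^sub>1 < c" "0 < c + A" "- A < c" using \<epsilon> by (auto simp: c_def A_def)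
  obtain C where C: "C \<ge> 0" "\<And>s. Re s \<ge> c \<Longrightarrow> norm (H s) \<le> C / (1 + norm s ^ 2)"
    using resolvent_transform_bound[OF holJ c(1,2)] unfolding H_def by blast
  define a where "a = max (- \<alpha>\<^sub>1) (- A)"
  have ac: "a < c" using c by (simp add: a_def)
  have ne: "2 * (s + of_real A) \<noteq> 0" if "a < Re s" for s
    using that by (auto simp: a_def complex_eq_iff)
  have hol: "H holomorphic_on {s. Re s > a}"
    unfolding H_def using ne
    by (intro holomorphic_intros holomorphic_on_subset[OF holJ]) (auto simp: a_def)
  note cont = continuous_on_vertical_line[OF hol ac]
  have bd: "norm (H (Complex c t)) \<le> C / (1 + t\<^sup>2)" for t
    by (rule vertical_line_bound[OF C])
  obtain K where K: "K \<ge> 0" "\<And>y. norm (mellin_inv c H y) \<le> K * y powr c"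
    using mellin_inv_bound[of H c C, OF cont bd] by blast
  define p where "p = (\<lambda>y. complex_of_real (1 / 2 * y powr (- A)))"
  define d where "d = (\<lambda>y. resolvent_R y - mellin_inv c H y - p y)"
  have pc: "continuous_on {1..} p" unfolding p_def by (intro continuous_intros) auto
  have hc: "continuous_on {1..} (mellin_inv c H)" by (rule mellin_inv_continuous[of H c C, OF cont bd])
  \<comment> \<open>A common growth exponent for the uniqueness argument: so far R is only known to
    be O(y^2), while the inverse transform is O(y^c).\<close>
  define b where "b = max 2 c"
  have Rb: "norm (resolvent_R y) \<le> 1 * y powr b" if "y \<ge> 1" for y
  proof -
    have "norm (resolvent_R y) \<le> y powr 2" using resolvent_R_bound[OF that] that by simp
    also have "\<dots> \<le> y powr b" using that by (intro powr_mono) (auto simp: b_def)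
    finally show ?thesis by simp
  qed
  have hb: "norm (mellin_inv c H y) \<le> K * y powr b" if "y \<ge> 1" for y
  proof -
    have "K * y powr c \<le> K * y powr b" using that K by (intro mult_left_mono powr_mono) (auto simp: b_def)
    then show ?thesis using K(2)[of y] by linarith
  qed
  have pb': "norm (p y) \<le> 1 / 2 * y powr c" if "y \<ge> 1" for y
  proof -
    have "y powr (- A) \<le> y powr c" using that c by (intro powr_mono) auto
    then show ?thesis unfolding p_def norm_of_real by simp
  qed
  have pb: "norm (p y) \<le> 1 / 2 * y powr b" if "y \<ge> 1" for y
  proof -
    have "y powr c \<le> y powr b" using that by (intro powr_mono) (auto simp: b_def)
    then show ?thesis using pb'[OF that] by linarith
  qed
  obtain N :: nat where N: "b + 1 \<le> real N" using real_arch_simple by blast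
  \<comment> \<open>At s = m the transform 1 - \<open>inv_gstar\<close> of R splits, by the choice
    of \<open>H\<close>, into the transforms of the inversion integral and of
    \<open>p\<close>.\<close>
  have zero: "mellin d (real m) = 0" if "m \<ge> N" for m :: nat
  proof -
    have m: "real m > b" "real m > c" "real m > 2" "m \<ge> 1" using that N by (auto simp: b_def)
    define k where "k = mellin kernel_k (real m)"
    have g: "gstar (- of_nat m) = 1 + k" unfolding k_def by (rule gstar_eq_mellin_kernel_k[OF m(4)])
    have "of_nat m \<notin> (\<int>\<^sub>\<le>\<^sub>0 :: complex set)" using m by (auto elim!: nonpos_Ints_cases' simp: complex_eq_iff)
    then have J: "inv_gstar (of_nat m) = 1 / (1 + k)" by (simp add: inv_gstar_def g)
    have "norm k \<le> 1 / (2 * real m)" unfolding k_def using m by (intro mellin_kernel_k_bound) auto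
    also have "\<dots> < 1" using m by simp
    finally have "1 + k \<noteq> 0" by (metis add_eq_0_iff2 less_irrefl norm_minus_cancel norm_one)
    then have R: "mellin resolvent_R (real m) = 1 - inv_gstar (of_nat m)"
      unfolding mellin_resolvent_R[OF m(3)] J k_def[symmetric] by (simp add: field_simps)
    have h: "mellin (mellin_inv c H) (real m) = H (of_nat m)"
      using mellin_mellin_inv[OF hol ac m(2) C] by simp
    have p: "mellin p (real m) = 1 / (2 * (of_nat m + of_real A))"
    proof -
      have "mellin p (real m) = (LINT y:{1<..}|lborel. 1 / 2 * complex_of_real y powr (of_real (- A - real m - 1)))"
        unfolding mellin_def
      proof (intro set_lebesgue_integral_cong ballI allI impI)
        fix y :: real assume "y \<in> {1<..}"
        then have y: "y > 1" by simp
        have "p y * of_real (y powr (- real m - 1)) = of_real (1 / 2 * (y powr (- A) * y powr (- real m - 1)))"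
          by (simp add: p_def)
        also have "y powr (- A) * y powr (- real m - 1) = y powr (- A - real m - 1)"
          using powr_add[of y "- A" "- real m - 1"] by (simp add: algebra_simps)
        finally show "p y * of_real (y powr (- real m - 1)) = 1 / 2 * complex_of_real y powr (of_real (- A - real m - 1))"
          using y by (simp add: powr_of_real del: of_real_diff of_real_minus)
      qed auto
      also have "\<dots> = 1 / 2 * (- 1 / (of_real (- A - real m - 1) + 1))"
        using m c by (subst set_integral_mult_right, subst set_integral_complex_powr_at_top) auto
      also have "\<dots> = 1 / (2 * (of_nat m + of_real A))"
      proof -
        have "of_real (- A - real m - 1) + 1 = - (of_nat m + of_real A :: complex)" by simp
        moreover have "1 / 2 * (- 1 / - x) = 1 / (2 * x)" for x :: complex by simp
        ultimately show ?thesis by (simp only:)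
      qed
      finally show ?thesis .
    qed
    have "mellin d (real m) = mellin resolvent_R (real m) - mellin (mellin_inv c H) (real m) - mellin p (real m)"
    proof -
      note iR = set_integrable_mellin[OF resolvent_R_continuous Rb m(1)]
      note ih = set_integrable_mellin[OF hc hb m(1)]
      note ip = set_integrable_mellin[OF pc pb m(1)]
      show ?thesis
        unfolding mellin_def d_def left_diff_distrib
        using set_integral_diff(2)[OF set_integral_diff(1)[OF iR ih] ip] set_integral_diff(2)[OF iR ih] by simp
    qed
    also have "\<dots> = 0" unfolding R h p by (simp add: H_def)
    finally show ?thesis .
  qed
  have d0: "d y = 0" if "y \<ge> 1" for y
  proof (rule mellin_zero_imp_zero[OF _ _ zero that])
    show "continuous_on {1..} d"
      unfolding d_def by (intro continuous_intros resolvent_R_continuous hc pc)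
    show "norm (d y) \<le> (1 + K + 1 / 2) * y powr b" if "y \<ge> 1" for y
    proof -
      have "norm (d y) \<le> norm (resolvent_R y) + norm (mellin_inv c H y) + norm (p y)"
        unfolding d_def
        using norm_triangle_ineq4[of "resolvent_R y - mellin_inv c H y" "p y"]
          norm_triangle_ineq4[of "resolvent_R y" "mellin_inv c H y"] by linarith
      also have "\<dots> \<le> 1 * y powr b + K * y powr b + 1 / 2 * y powr b"
        using Rb[OF that] hb[OF that] pb[OF that] by linarith
      finally show ?thesis by (simp add: algebra_simps)
    qed
  qed
  have "norm (resolvent_R y) \<le> (K + 1 / 2) * norm (complex_of_real (y powr c))" if "y \<ge> 1" for y
  proof -
    have "resolvent_R y = mellin_inv c H y + p y" using d0[OF that] by (simp add: d_def algebra_simps)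
    also have "norm \<dots> \<le> norm (mellin_inv c H y) + norm (p y)" by (rule norm_triangle_ineq)
    also have "\<dots> \<le> K * y powr c + 1 / 2 * y powr c" using K(2)[of y] pb'[OF that] by linarith
    finally show ?thesis by (simp add: algebra_simps)
  qed
  then have "resolvent_R \<in> O[at_top](\<lambda>y. complex_of_real (y powr c))"
    by (intro bigoI[of _ "K + 1 / 2"] eventually_mono[OF eventually_ge_at_top[of 1]])
  then show "resolvent_R \<in> O[at_top](\<lambda>y. complex_of_real (y powr (- \<alpha>\<^sub>1 + \<epsilon>)))"
    by (simp only: c_def)
qed

end
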